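(* Let $q\ge 3$ be a prime power and let $X\subset\mathbb{P}^3(\mathbb{F}_q)$ be a quadric cone. The codewords of second weight of $C_2(X)$ correspond to the quadrics of the following types, i.e. a codeword of $C_2(X)$ has weight equal to the second weight if and only if it equals $c(f)$ for some form $f$ of degree 2 such that $Z(f)$ is one of the following: (1) a union of two distinct planes, each passing through a pair of generators of $X$, such that the line of intersection of the two planes is a generator of $X$; (2) a union of two planes, one tangent to the cone $X$ and the second passing through a pair of generators of $X$, such that the line of intersection $l$ of the two planes satisfies $l\in\mathcal{L}_1^{+}$ (for $q$ odd) or $l\in\mathcal{L}_1^{\prime\prime}$ (for $q$ even).
   Context: A quadric in $\mathbb{P}^3(\mathbb{F}_q)$ is the zero set $Z(f)$ of a nonzero form $f$ of degree 2 in $x_0,\dots,x_3$ over $\mathbb{F}_q$; its rank is the smallest number of indeterminates appearing in $f$ under any linear change of coordinates. A quadric cone is a quadric of rank 3; it consists of $q+1$ lines, called its generators, through a common point $S$, its vertex. A pair of generators means two distinct generators. A tangent plane to the cone is a plane through $S$ meeting the cone in exactly one (repeated) generator. For $q$ odd, $\mathcal{L}_1^{+}$ denotes the set of external vertex tangents, i.e. the lines through $S$, not generators, that are intersections of pairs of tangent planes. For $q$ even, all tangent planes share a common line through $S$, the nuclear line, and $\mathcal{L}_1^{\prime\prime}$ denotes the set of lines through $S$ that are neither generators nor the nuclear line. Let $F$ be the $\mathbb{F}_q$-vector space of forms of degree 2 in $x_0,\dots,x_3$ over $\mathbb{F}_q$ (including $0$). Each point $x\in\mathbb{P}^3(\mathbb{F}_q)$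 is represented by its unique homogeneous coordinate vector whose first nonzero coordinate equals $1$. The functional code $C_2(X)$ is the image of the linear map $c:F\to\mathbb{F}_q^{|X|}$, $c(f)=(f(x_0,\dots,x_3))_{x\in X}$. The weight of a codeword is its number of nonzero coordinates. The weights are listed in increasing order, the first weight being the minimum distance (stated by the paper to be $q(q-3)$) and the second weight being the next smallest (stated by the paper to be $q(q-2)$).
   Formalization: For q = 3 the smallest nonzero weight is already q(q-2) = 3, so "second weight" fails literally there; the result is proved for weight q(q-2) for all q ≥ 3, and for the second smallest nonzero weight for q ≥ 4. *)

theory Defs
  imports "HOL-Analysis.Analysis"
begin

text \<open>
  The coordinates \<open>x\<^sub>0, \<dots>, x\<^sub>3\<close> are \<open>x $ 0, \<dots>, x $ 3\<close>, where the index type \<open>4\<close> is the type of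
  residues modulo 4 with the order \<open>0 < 1 < 2 < 3\<close>. The finite field is a type \<open>'a\<close>,
  and \<open>q\<close> is \<open>CARD('a)\<close>.
\<close>

subsection \<open>Projective space\<close>

text \<open>A projective point is identified with its normalized coordinate vector.\<close>

definition PG3 :: "('a::field ^ 4) set" where
  "PG3 = {x. \<exists>i. x $ i = 1 \<and> (\<forall>j<i. x $ j = 0)}"

definition proj_subspaces :: "nat \<Rightarrow> ('a::field ^ 4) set set" where
  "proj_subspaces d = {U \<inter> PG3 | U. vec.subspace U \<and> vec.dim U = d + 1}"

definition proj_lines :: "('a::field ^ 4) set set" where
  "proj_lines = proj_subspaces 1"

definition proj_planes :: "('a::field ^ 4) set set" where
  "proj_planes = proj_subspaces 2"

subsection \<open>Forms of degree 2 and quadrics\<close>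

text \<open>
  The form with coefficient \<open>c i j\<close> at the monomial \<open>x\<^sub>i x\<^sub>j\<close> for \<open>i \<le> j\<close>. A form of degree 2 is
  represented by its polynomial function; lemma \<open>qform_eq_iff\<close> shows that, over every field,
  this function determines the coefficients, so nothing is lost.
\<close>

definition qform :: "(4 \<Rightarrow> 4 \<Rightarrow> 'a::field) \<Rightarrow> 'a ^ 4 \<Rightarrow> 'a" where
  "qform c x = (\<Sum>i\<in>UNIV. \<Sum>j\<in>{i..}. c i j * x $ i * x $ j)"

definition quad_forms :: "('a::field ^ 4 \<Rightarrow> 'a) set" where
  "quad_forms = range qform"

lemma qform_axis:
  "qform c (axis k 1) = c k k"
proof -
  have "(\<Sum>j\<in>{i..}. c i j * axis k 1 $ i * axis k 1 $ j) = (if i = k then c k k else 0)" for i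
  proof (cases "i = k")
    case True
    have "(\<Sum>j\<in>{k..}. c k j * axis k 1 $ k * axis k 1 $ j) = (\<Sum>j\<in>{k..}. if j = k then c k k else 0)"
      by (intro sum.cong) (auto simp: axis_def)
    then show ?thesis using True by (simp add: sum.delta)
  qed (simp add: axis_def)
  then show ?thesis unfolding qform_def by simp
qed

lemma qform_axis2:
  assumes "k < l"
  shows "qform c (axis k 1 + axis l 1) = c k k + c l l + c k l"
proof -
  let ?x = "axis k 1 + axis l 1 :: 'a ^ 4"
  have x: "?x $ j = (if j = k then 1 else 0) + (if j = l then 1 else 0)" for j
    by (auto simp: axis_def)
  have "(\<Sum>j\<in>{i..}. c i j * ?x $ i * ?x $ j) =
      (if i = k then c k k + c k l else 0) + (if i = l then c l l else 0)" for i
  proof -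
    have "(\<Sum>j\<in>{i..}. c i j * ?x $ i * ?x $ j) =
        ?x $ i * ((\<Sum>j\<in>{i..}. if j = k then c i k else 0) + (\<Sum>j\<in>{i..}. if j = l then c i l else 0))"
      unfolding sum.distrib[symmetric] sum_distrib_left
      using assms by (intro sum.cong refl) (auto simp: axis_def)
    also have "\<dots> = (if i = k then c k k + c k l else 0) + (if i = l then c l l else 0)"
      using assms by (auto simp: axis_def)
    finally show ?thesis .
  qed
  then show ?thesis unfolding qform_def by (simp add: sum.distrib)
qed

lemma qform_eq_iff:
  "qform c = qform d \<longleftrightarrow> (\<forall>i j. i \<le> j \<longrightarrow> c i j = d i j)"
proof
  assume eq: "qform c = qform d"
  have diag: "c k k = d k k" for k
    using eq qform_axis[of c k] qform_axis[of d k] by simp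
  show "\<forall>i j. i \<le> j \<longrightarrow> c i j = d i j"
  proof (intro allI impI)
    fix i j :: 4 assume "i \<le> j"
    show "c i j = d i j"
    proof (cases "i = j")
      case False
      with \<open>i \<le> j\<close> have "i < j" by simp
      with eq qform_axis2[of i j c] qform_axis2[of i j d] diag show ?thesis by simp
    qed (use diag in simp)
  qed
next
  assume "\<forall>i j. i \<le> j \<longrightarrow> c i j = d i j"
  then show "qform c = qform d"
    unfolding qform_def by (intro ext sum.cong refl) auto
qed

text \<open>The indeterminates (by index) that appear in a form.\<close>

definition indets :: "('a::field ^ 4 \<Rightarrow> 'a) \<Rightarrow> 4 set" where
  "indets f = {k. \<exists>c i j. f = qform c \<and> i \<le> j \<and> c i j \<noteq> 0 \<and> (k = i \<or> k = j)}"

definition form_rank :: "('a::field ^ 4 \<Rightarrow> 'a) \<Rightarrow> nat" where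
  "form_rank f = (LEAST r. \<exists>A :: 'a ^ 4 ^ 4. invertible A \<and> r = card (indets (\<lambda>x. f (A *v x))))"

definition zero_set :: "('a::field ^ 4 \<Rightarrow> 'a) \<Rightarrow> ('a ^ 4) set" where
  "zero_set f = {x \<in> PG3. f x = 0}"

definition quadric_cone :: "('a::field ^ 4) set \<Rightarrow> bool" where
  "quadric_cone X \<longleftrightarrow> (\<exists>f\<in>quad_forms. f \<noteq> (\<lambda>x. 0) \<and> form_rank f = 3 \<and> X = zero_set f)"

subsection \<open>Lines and planes related to a cone\<close>

text \<open>The generators of a cone are precisely the lines contained in it.\<close>

definition generators :: "('a::field ^ 4) set \<Rightarrow> ('a ^ 4) set set" where
  "generators X = {l \<in> proj_lines. l \<subseteq> X}"

definition vertex :: "('a::field ^ 4) set \<Rightarrow> 'a ^ 4" where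
  "vertex X = (THE S. S \<in> PG3 \<and> (\<forall>g\<in>generators X. S \<in> g))"

definition tangent_plane :: "('a::field ^ 4) set \<Rightarrow> ('a ^ 4) set \<Rightarrow> bool" where
  "tangent_plane X P \<longleftrightarrow> P \<in> proj_planes \<and> vertex X \<in> P \<and> P \<inter> X \<in> generators X"

definition through_generator_pair :: "('a::field ^ 4) set \<Rightarrow> ('a ^ 4) set \<Rightarrow> bool" where
  "through_generator_pair X P \<longleftrightarrow> P \<in> proj_planes \<and>
     (\<exists>g\<in>generators X. \<exists>h\<in>generators X. g \<noteq> h \<and> g \<subseteq> P \<and> h \<subseteq> P)"

text \<open>\<open>\<L>\<^sub>1\<^sup>+\<close>, for \<open>q\<close> odd\<close>

definition external_vertex_tangents :: "('a::field ^ 4) set \<Rightarrow> ('a ^ 4) set set" where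
  "external_vertex_tangents X = {l \<in> proj_lines. vertex X \<in> l \<and> l \<notin> generators X \<and>
     (\<exists>P Q. tangent_plane X P \<and> tangent_plane X Q \<and> P \<noteq> Q \<and> l = P \<inter> Q)}"

definition nuclear_line :: "('a::field ^ 4) set \<Rightarrow> ('a ^ 4) set" where
  "nuclear_line X = (THE n. n \<in> proj_lines \<and> vertex X \<in> n \<and> (\<forall>P. tangent_plane X P \<longrightarrow> n \<subseteq> P))"

text \<open>\<open>\<L>\<^sub>1''\<close>, for \<open>q\<close> even\<close>

definition nonnuclear_vertex_lines :: "('a::field ^ 4) set \<Rightarrow> ('a ^ 4) set set" where
  "nonnuclear_vertex_lines X =
     {l \<in> proj_lines. vertex X \<in> l \<and> l \<notin> generators X \<and> l \<noteq> nuclear_line X}"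

definition two_secant_planes :: "('a::field ^ 4) set \<Rightarrow> ('a ^ 4) set \<Rightarrow> bool" where
  "two_secant_planes X Z \<longleftrightarrow> (\<exists>P Q. Z = P \<union> Q \<and> P \<noteq> Q \<and>
     through_generator_pair X P \<and> through_generator_pair X Q \<and> P \<inter> Q \<in> generators X)"

definition tangent_and_secant_plane :: "('a::{field,finite} ^ 4) set \<Rightarrow> ('a ^ 4) set \<Rightarrow> bool" where
  "tangent_and_secant_plane X Z \<longleftrightarrow> (\<exists>P Q. Z = P \<union> Q \<and>
     tangent_plane X P \<and> through_generator_pair X Q \<and>
     P \<inter> Q \<in> (if odd CARD('a) then external_vertex_tangents X else nonnuclear_vertex_lines X))"

subsection \<open>The functional code\<close>

text \<open>A word of \<open>\<F>\<^sub>q\<^bsup>|X|\<^esup>\<close> is a function on \<open>X\<close>, encoded as usual as \<open>undefined\<close> outside of \<open>X\<close>.\<close>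

definition codeword :: "('a::field ^ 4) set \<Rightarrow> ('a ^ 4 \<Rightarrow> 'a) \<Rightarrow> 'a ^ 4 \<Rightarrow> 'a" where
  "codeword X f = restrict f X"

definition func_code :: "('a::field ^ 4) set \<Rightarrow> ('a ^ 4 \<Rightarrow> 'a) set" where
  "func_code X = codeword X ` quad_forms"

definition weight :: "('a::field ^ 4) set \<Rightarrow> ('a ^ 4 \<Rightarrow> 'a) \<Rightarrow> nat" where
  "weight X v = card {x \<in> X. v x \<noteq> 0}"

text \<open>
  These are the two smallest positive weights: \<open>q(q-3)\<close> and \<open>q(q-2)\<close> if \<open>q \<ge> 4\<close>. If \<open>q = 3\<close>, then
  \<open>q(q-3) = 0\<close> is the weight of the zero codeword only, so that \<open>q(q-2) = 3\<close> follows \<open>q(q-3)\<close> in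
  the list of all weights, but is \<open>min_distance X\<close> instead of \<open>second_weight X\<close>.
\<close>

definition min_distance :: "('a::field ^ 4) set \<Rightarrow> nat" where
  "min_distance X = (LEAST w. w \<in> weight X ` func_code X \<and> 0 < w)"

definition second_weight :: "('a::field ^ 4) set \<Rightarrow> nat" where
  "second_weight X = (LEAST w. w \<in> weight X ` func_code X \<and> min_distance X < w)"

end

theory Submission
  imports Defs
begin

text \<open>
  In suitable coordinates the cone is \<open>y\<^sub>0 y\<^sub>2 = y\<^sub>1\<^sup>2\<close>, so that its points other than the vertex
  are \<open>(s\<^sup>2, s t, t\<^sup>2, w)\<close> with \<open>(s : t)\<close> on the projective line. A form restricts to
  \<open>a w\<^sup>2 + w b(s, t) + c(s, t)\<close> with \<open>b\<close> binary quadratic and \<open>c\<close> binary quartic. A word with at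
  least \<open>3q + 1\<close> zeros has \<open>a = 0\<close> and \<open>b = 0\<close>, and then it has \<open>1 + q m\<close> zeros, where \<open>m\<close> is the
  number of roots of \<open>c\<close>. Weight \<open>q(q - 2)\<close> means \<open>m = 3\<close>, and a quartic with exactly three
  roots is \<open>k l\<^sub>1\<^sup>2 l\<^sub>2 l\<^sub>3\<close>; this is the restriction of the product of the planes spanned by the
  generators 1, 2 and 1, 3. Every word of this weight therefore comes from a quadric of type (1).
  Conversely, both types of quadrics meet the cone in \<open>3q + 1\<close> points by inclusion-exclusion; for
  type (2) it only matters that the common line of the planes meets the cone in the vertex alone.
\<close>

subsection \<open>Quadratic forms in four variables\<close>

text \<open>The obstacle is the normal form over every finite field: rank counts indeterminates, and
  in characteristic 2 a form cannot in general be diagonalized. So missing indeterminates become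
  directions of translation invariance, an isotropic vector is found by counting, and a hyperbolic
  pair is split off, which works in every characteristic. The number 3q + 1 is an exact threshold: a
  form with a = 0 and b having two roots can have 3q zeros. A form matters only modulo the equation
  of the cone, so one word comes from quadrics of different shapes. If l1, l2, l3 are the binary
  linear forms of three generators, the plane through generators 1 and 2 restricts to l1 l2 and the
  tangent plane along generator 1 to l1^2. Hence tangent plane 1 with plane 2, 3 gives the same
  quartic as plane 1, 2 with plane 1, 3, and the two types of quadrics yield the same words. The
  bound q >= 4 enters with the smaller weight: it belongs to quartics with exactly four roots, and
  for q = 3 four roots exhaust the projective line.\<close>

lemma UNIV_index4: "(UNIV :: 4 set) = {0, 1, 2, 3}"
proof -
  \<comment> \<open>\<open>UNIV_4\<close> lists the residues as 1, 2, 3, 4; the last one is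
    0.\<close>
  have eq: "(4 :: 4) = 0" by simp
  show ?thesis using UNIV_4 unfolding eq by blast
qed

lemma all_index4: "(\<forall>i :: 4. P i) \<longleftrightarrow> P 0 \<and> P 1 \<and> P 2 \<and> P 3"
  by (metis UNIV_I UNIV_index4 empty_iff insert_iff)

lemma less_index4: "(0 :: 4) < 1" "(0 :: 4) < 2" "(0 :: 4) < 3" "(1 :: 4) < 2" "(1 :: 4) < 3" "(2 :: 4) < 3"
  by (simp_all add: less_bit0_def bit0.Rep_0 bit0.Rep_1 bit0.Rep_numeral)

lemma sum_index4: "(\<Sum>i\<in>UNIV. g (i :: 4)) = g 0 + g 1 + g 2 + (g 3 :: 'b :: comm_monoid_add)"
proof -
  have "(\<Sum>i\<in>{0, 1, 2, 3}. g (i :: 4)) = g 0 + (g 1 + (g 2 + g 3))"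
    using less_index4[THEN less_imp_neq] by simp
  then show ?thesis unfolding UNIV_index4 by (simp only: add.assoc)
qed

lemma qform_expand:
  "qform c x = c 0 0 * x$0 * x$0 + c 0 1 * x$0 * x$1 + c 0 2 * x$0 * x$2 + c 0 3 * x$0 * x$3
     + c 1 1 * x$1 * x$1 + c 1 2 * x$1 * x$2 + c 1 3 * x$1 * x$3
     + c 2 2 * x$2 * x$2 + c 2 3 * x$2 * x$3 + c 3 3 * x$3 * x$3"
proof -
  have "{0 :: 4..} = {0, 1, 2, 3}" "{1 :: 4..} = {1, 2, 3}" "{2 :: 4..} = {2, 3}" "{3 :: 4..} = {3}"
    unfolding set_eq_iff all_index4 atLeast_iff
    by (simp_all add: less_eq_bit0_def bit0.Rep_0 bit0.Rep_1 bit0.Rep_numeral)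
  then show ?thesis
    unfolding qform_def sum_index4 by simp
qed

lemma quad_formsI:
  assumes "\<And>x. f x = a * x$0 * x$0 + b * x$0 * x$1 + c * x$0 * x$2 + d * x$0 * x$3
     + e * x$1 * x$1 + g * x$1 * x$2 + h * x$1 * x$3
     + i * x$2 * x$2 + j * x$2 * x$3 + k * x$3 * (x$3 :: 'a :: field)"
  shows "f \<in> quad_forms"
proof -
  define cc :: "4 \<Rightarrow> 4 \<Rightarrow> 'a" where
    "cc = (\<lambda>r s. if r = 0 then (if s = 0 then a else if s = 1 then b else if s = 2 then c else d)
       else if r = 1 then (if s = 1 then e else if s = 2 then g else h)
       else if r = 2 then (if s = 2 then i else j) else k)"
  have "f = qform cc"
    by (rule ext) (simp add: qform_expand assms cc_def)
  then show ?thesis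
    unfolding quad_forms_def by blast
qed

lemma quad_forms_add:
  assumes "f \<in> quad_forms" "g \<in> quad_forms"
  shows "(\<lambda>x. f x + g x) \<in> quad_forms"
proof -
  obtain c d where "f = qform c" "g = qform d"
    using assms by (auto simp: quad_forms_def)
  then have "(\<lambda>x. f x + g x) = qform (\<lambda>i j. c i j + d i j)"
    by (simp add: fun_eq_iff qform_def sum.distrib algebra_simps)
  then show ?thesis by (simp add: quad_forms_def)
qed

lemma quad_forms_scale:
  assumes "f \<in> quad_forms"
  shows "(\<lambda>x. k * f x) \<in> quad_forms"
proof -
  obtain c where "f = qform c"
    using assms by (auto simp: quad_forms_def)
  then have "(\<lambda>x. k * f x) = qform (\<lambda>i j. k * c i j)"
    by (simp add: fun_eq_iff qform_def sum_distrib_left algebra_simps)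
  then show ?thesis by (simp add: quad_forms_def)
qed

lemma quad_forms_sum:
  fixes f :: "'i \<Rightarrow> 'a::field ^ 4 \<Rightarrow> 'a"
  assumes "finite I" "\<And>i. i \<in> I \<Longrightarrow> f i \<in> quad_forms"
  shows "(\<lambda>x. \<Sum>i\<in>I. f i x) \<in> quad_forms"
  using assms
proof (induction I rule: finite_induct)
  case empty
  have "(\<lambda>x :: 'a^4. 0) = qform (\<lambda>i j. 0)" by (simp add: fun_eq_iff qform_def)
  then show ?case by (simp add: quad_forms_def)
qed (simp add: quad_forms_add)

definition linfun :: "'a :: field ^ 4 \<Rightarrow> 'a ^ 4 \<Rightarrow> 'a" where
  "linfun l x = l$0 * x$0 + l$1 * x$1 + l$2 * x$2 + l$3 * x$3"

lemma quad_forms_linfun_mult: "(\<lambda>x. linfun l x * linfun m x) \<in> quad_forms"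
  by (rule quad_formsI[where a = "l$0 * m$0" and b = "l$0 * m$1 + l$1 * m$0"
        and c = "l$0 * m$2 + l$2 * m$0" and d = "l$0 * m$3 + l$3 * m$0"
        and e = "l$1 * m$1" and g = "l$1 * m$2 + l$2 * m$1" and h = "l$1 * m$3 + l$3 * m$1"
        and i = "l$2 * m$2" and j = "l$2 * m$3 + l$3 * m$2" and k = "l$3 * m$3"])
    (simp add: linfun_def algebra_simps)

lemma matrix_vector_mult_nth_linfun: "(A *v x) $ i = linfun (A $ i) x"
  by (simp add: matrix_vector_mult_def linfun_def sum_index4)

lemma quad_forms_compose:
  assumes "f \<in> quad_forms"
  shows "(\<lambda>x. f (A *v x)) \<in> quad_forms"
proof -
  obtain c where "f = qform c"
    using assms by (auto simp: quad_forms_def)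
  then have "(\<lambda>x. f (A *v x)) = (\<lambda>x. \<Sum>i\<in>UNIV. \<Sum>j\<in>{i..}. c i j * (linfun (A$i) x * linfun (A$j) x))"
    by (simp add: fun_eq_iff qform_def matrix_vector_mult_nth_linfun mult.assoc)
  then show ?thesis
    by (simp add: quad_forms_sum quad_forms_scale quad_forms_linfun_mult)
qed

lemma quad_form_scale:
  assumes "f \<in> quad_forms"
  shows "f (k *s x) = k\<^sup>2 * f x"
  using assms by (auto simp: quad_forms_def qform_def sum_distrib_left power2_eq_square algebra_simps)

text \<open>The bilinear form associated with a quadratic form, without a factor 1/2 so that
  characteristic 2 is included; there it no longer determines \<open>f\<close>.\<close>

definition polar :: "('a::field ^ 4 \<Rightarrow> 'a) \<Rightarrow> 'a ^ 4 \<Rightarrow> 'a ^ 4 \<Rightarrow> 'a" where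
  "polar f x y = f (x + y) - f x - f y"

lemma quad_form_add: "f (x + y) = f x + f y + polar f x y"
  by (simp add: polar_def)

lemma polar_commute: "polar f x y = polar f y x"
  by (simp add: polar_def add.commute)

lemma polar_qform: "polar (qform c) x y = (\<Sum>i\<in>UNIV. \<Sum>j\<in>{i..}. c i j * (x$i * y$j + y$i * x$j))"
  by (simp add: polar_def qform_def sum_subtractf[symmetric] algebra_simps)

lemma polar_add_left:
  assumes "f \<in> quad_forms"
  shows "polar f (x + y) z = polar f x z + polar f y z"
  using assms by (auto simp: quad_forms_def polar_qform sum.distrib[symmetric] algebra_simps)

lemma polar_scale_left:
  assumes "f \<in> quad_forms"
  shows "polar f (k *s x) z = k * polar f x z"
  using assms by (auto simp: quad_forms_def polar_qform sum_distrib_left algebra_simps)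

lemma polar_add_right:
  assumes "f \<in> quad_forms"
  shows "polar f z (x + y) = polar f z x + polar f z y"
  using polar_add_left[OF assms] by (simp add: polar_commute)

lemma polar_scale_right:
  assumes "f \<in> quad_forms"
  shows "polar f z (k *s x) = k * polar f z x"
  using polar_scale_left[OF assms] by (simp add: polar_commute)

lemma polar_self:
  assumes "f \<in> quad_forms"
  shows "polar f x x = 2 * f x"
  using assms by (auto simp: quad_forms_def polar_qform qform_def sum_distrib_left algebra_simps)

lemma quad_form_0:
  assumes "f \<in> quad_forms"
  shows "f 0 = 0"
  using quad_form_scale[OF assms, of 0 0] by simp

section \<open>Normalized representatives of projective points\<close>

lemma PG3_nonzero: "x \<in> PG3 \<Longrightarrow> x \<noteq> 0"
  by (auto simp: PG3_def)

lemma PG3_scale_exists: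
  assumes "x \<noteq> 0"
  shows "\<exists>k. k \<noteq> 0 \<and> k *s x \<in> PG3"
proof -
  define i where "i = Min {i. x $ i \<noteq> 0}"
  have ne: "{i. x $ i \<noteq> 0} \<noteq> {}"
    using assms by (auto simp: vec_eq_iff)
  have i: "x $ i \<noteq> 0"
    using Min_in[OF _ ne] by (simp add: i_def)
  have "x $ j = 0" if "j < i" for j
    using Min_le[OF finite[of "{i. x $ i \<noteq> 0}"], of j] that unfolding i_def by fastforce
  then have "inverse (x$i) *s x \<in> PG3"
    using i by (auto simp: PG3_def intro!: exI[of _ i])
  then show ?thesis using i by (intro exI[of _ "inverse (x$i)"]) simp
qed

lemma PG3_scale_unique:
  assumes "x \<in> PG3" "k *s x \<in> PG3"
  shows "k = 1"
proof -
  obtain i where i: "x $ i = 1" "\<And>j. j < i \<Longrightarrow> x $ j = 0"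
    using assms by (auto simp: PG3_def)
  obtain j where j: "k * x $ j = 1" "\<And>l. l < j \<Longrightarrow> k * x $ l = 0"
    using assms by (auto simp: PG3_def)
  have "\<not> i < j" using i(1) j by force
  moreover have "\<not> j < i" using i j(1) by force
  ultimately have "i = j" by simp
  then show ?thesis using i j by simp
qed

text \<open>The representative in \<open>PG3\<close> of the point spanned by a nonzero
  \<open>x\<close>; \<open>PG3_scale_unique\<close> makes the choice harmless.\<close>

definition pnorm :: "'a::field ^ 4 \<Rightarrow> 'a ^ 4" where
  "pnorm x = (SOME k. k \<noteq> 0 \<and> k *s x \<in> PG3) *s x"

lemma pnorm:
  assumes "x \<noteq> 0"
  shows "pnorm x \<in> PG3" and "\<exists>k. k \<noteq> 0 \<and> pnorm x = k *s x"
  using someI_ex[OF PG3_scale_exists[OF assms]] by (auto simp: pnorm_def)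

lemma pnorm_eqI:
  assumes "y \<in> PG3" "y = k *s x"
  shows "pnorm x = y"
proof -
  have k: "k \<noteq> 0" "x \<noteq> 0" using assms PG3_nonzero[OF assms(1)] by auto
  obtain m where m: "m \<noteq> 0" "pnorm x = m *s x" using pnorm(2)[OF k(2)] by auto
  have "pnorm x = (m / k) *s y" using m assms k by simp
  with PG3_scale_unique[OF assms(1), of "m / k"] pnorm(1)[OF k(2)] show ?thesis
    by simp
qed

subsection \<open>Normal form of a quadric cone\<close>

text \<open>Invariance under translation along an axis expresses a missing indeterminate without
  coefficients, and so it can be carried through a change of coordinates.\<close>

lemma not_in_indets_imp_invariant:
  assumes "h \<in> quad_forms" "k \<notin> indets h"
  shows "h (x + t *s axis k 1) = h x"
proof -
  obtain c where c: "h = qform c"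
    using assms(1) by (auto simp: quad_forms_def)
  have "c i j * (x + t *s axis k 1) $ i * (x + t *s axis k 1) $ j = c i j * x $ i * x $ j" if "i \<le> j" for i j
  proof (cases "c i j = 0")
    case False
    with that assms(2) c have "k \<noteq> i" "k \<noteq> j" unfolding indets_def by blast+
    then show ?thesis by (simp add: axis_def)
  qed simp
  then show ?thesis
    unfolding c qform_def by (intro sum.cong refl) auto
qed

text \<open>Coefficients can be read off from values: \<open>c k k\<close> is the value at
  \<open>axis k 1\<close>, and a mixed coefficient is the defect of additivity at a sum of two axis
  vectors. Invariance along axis \<open>k\<close> makes those that involve \<open>k\<close>
  vanish.\<close>

lemma invariant_imp_not_in_indets:
  assumes h: "\<And>x t. h (x + t *s axis k 1) = h x"
  shows "k \<notin> indets h"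
proof
  assume "k \<in> indets h"
  then obtain c i j where c: "h = qform c" "i \<le> j" "c i j \<noteq> 0" "k = i \<or> k = j"
    unfolding indets_def by blast
  have kk: "c k k = 0"
    using h[of 0 1] qform_axis[of c k] by (simp add: c(1) quad_form_0 quad_forms_def)
  have inv: "h (axis k 1 + axis l 1) = h (axis l 1)" for l
    using h[of "axis l 1" 1] by (simp add: add.commute)
  show False
  proof (cases "i = j")
    case True
    then show False using c kk by auto
  next
    case False
    then have "h (axis i 1 + axis j 1) = c i i + c j j + c i j"
      using c qform_axis2[of i j c] by simp
    moreover have "h (axis i 1 + axis j 1) = c i i + c j j"
      using c(4) inv[of i] inv[of j] kk qform_axis[of c i] qform_axis[of c j] c(1)
      by (auto simp: add.commute)
    ultimately show False using c(3) by simp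
  qed
qed

text \<open>Serves to refute degenerate cases: two independent directions of invariance would push
  the rank of the cone down to 2.\<close>

lemma form_rank_le:
  fixes f :: "'a::field ^ 4 \<Rightarrow> 'a" and A :: "'a ^ 4 ^ 4"
  assumes "invertible A"
    and "\<And>k x t. k \<in> K \<Longrightarrow> f (A *v (x + t *s axis k 1)) = f (A *v x)"
  shows "form_rank f \<le> 4 - card K"
proof -
  have "form_rank f \<le> card (indets (\<lambda>x. f (A *v x)))"
    unfolding form_rank_def using assms(1) by (intro Least_le) blast
  also have "indets (\<lambda>x. f (A *v x)) \<subseteq> UNIV - K"
    using invariant_imp_not_in_indets[of "\<lambda>x. f (A *v x)"] assms(2) by blast
  then have "card (indets (\<lambda>x. f (A *v x))) \<le> card (UNIV - K)"
    by (intro card_mono) auto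
  also have "\<dots> = 4 - card K"
    by (simp add: card_Diff_subset)
  finally show ?thesis .
qed

text \<open>Coordinates that attain the minimum miss some indeterminate \<open>k\<close>, and the
  image of \<open>axis k 1\<close> is a direction along which \<open>f\<close> is constant. For a
  cone this is the direction of the vertex.\<close>

lemma form_rank_less_4_imp_radical:
  fixes f :: "'a::field ^ 4 \<Rightarrow> 'a"
  assumes "f \<in> quad_forms" "form_rank f < 4"
  obtains e where "e \<noteq> 0" "\<And>x t. f (x + t *s e) = f x"
proof -
  have "\<exists>r. \<exists>A :: 'a ^ 4 ^ 4. invertible A \<and> r = card (indets (\<lambda>x. f (A *v x)))"
    by (intro exI[of _ "card (indets (\<lambda>x. f (mat 1 *v x)))"] exI[of _ "mat 1"])
      (auto simp: invertible_def intro!: exI[of _ "mat 1"])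
  then have "\<exists>A :: 'a ^ 4 ^ 4. invertible A \<and> form_rank f = card (indets (\<lambda>x. f (A *v x)))"
    unfolding form_rank_def by (rule LeastI_ex)
  then obtain A :: "'a ^ 4 ^ 4" where A: "invertible A" "card (indets (\<lambda>x. f (A *v x))) < 4"
    using assms(2) by metis
  obtain k where k: "k \<notin> indets (\<lambda>x. f (A *v x))"
  proof -
    have "indets (\<lambda>x. f (A *v x)) \<noteq> UNIV" using A(2) by auto
    then show ?thesis using that by blast
  qed
  obtain B where B: "A ** B = mat 1" "B ** A = mat 1"
    using A(1) by (auto simp: invertible_def)
  have "f (A *v (x + t *s axis k 1)) = f (A *v x)" for x t
    using not_in_indets_imp_invariant[OF quad_forms_compose[OF assms(1)] k] .
  from this[of "B *v _"] have "f (x + t *s (A *v axis k 1)) = f x" for x t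
    by (simp add: matrix_vector_right_distrib vector_scalar_commute matrix_vector_mul_assoc B)
  moreover have "A *v axis k 1 \<noteq> 0"
  proof
    assume "A *v axis k 1 = 0"
    then have "B *v (A *v axis k 1) = 0" by simp
    then show False
      by (simp add: matrix_vector_mul_assoc B axis_eq_0_iff)
  qed
  ultimately show ?thesis using that by blast
qed

text \<open>The columns are basis vectors in the order of the normal form: \<open>p\<close> and
  \<open>r\<close> carry the product \<open>y$0 * y$2\<close>, \<open>u\<close> carries the square,
  and \<open>e\<close> is the vertex.\<close>

definition frame :: "'a::field ^ 4 \<Rightarrow> 'a ^ 4 \<Rightarrow> 'a ^ 4 \<Rightarrow> 'a ^ 4 \<Rightarrow> 'a ^ 4 ^ 4" where
  "frame p u r e = (\<chi> i j. (if j = 0 then p else if j = 1 then u else if j = 2 then r else e) $ i)"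

lemma frame_mult: "frame p u r e *v y = y$0 *s p + y$1 *s u + y$2 *s r + y$3 *s e"
  by (simp add: vec_eq_iff frame_def matrix_vector_mult_def sum_index4 mult.commute)

lemma span_scale_cancel:
  fixes x :: "'a::field ^ 4"
  assumes "k *s x \<in> vec.span S" "k \<noteq> 0"
  shows "x \<in> vec.span S"
  using vec.span_scale[OF assms(1), of "inverse k"] assms(2) by simp

text \<open>The hypotheses follow the order in which the vectors get constructed, \<open>e\<close>,
  \<open>p\<close>, \<open>r\<close>, \<open>u\<close>, and not the order of the columns.\<close>

lemma invertible_frame:
  assumes "e \<noteq> 0" "p \<notin> vec.span {e}" "r \<notin> vec.span {p, e}" "u \<notin> vec.span {r, p, e}"
  shows "invertible (frame p u r e)"
proof -
  have "y = 0" if "frame p u r e *v y = 0" for y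
  proof -
    have eq: "y$0 *s p + y$1 *s u + y$2 *s r + y$3 *s e = 0"
      using that by (simp add: frame_mult)
    have 1: "y$1 = 0"
    proof (rule ccontr)
      assume n: "y$1 \<noteq> 0"
      have "y$1 *s u = - (y$2) *s r + (- (y$0) *s p + - (y$3) *s e)"
        using eq by (simp add: algebra_simps eq_neg_iff_add_eq_0)
      also have "\<dots> \<in> vec.span {r, p, e}"
        by (intro vec.span_add vec.span_scale vec.span_base) auto
      finally show False using n assms(4) by (blast dest: span_scale_cancel)
    qed
    have 2: "y$2 = 0"
    proof (rule ccontr)
      assume n: "y$2 \<noteq> 0"
      have "y$2 *s r = - (y$0) *s p + - (y$3) *s e"
        using eq 1 by (simp add: algebra_simps eq_neg_iff_add_eq_0)
      also have "\<dots> \<in> vec.span {p, e}"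
        by (intro vec.span_add vec.span_scale vec.span_base) auto
      finally show False using n assms(3) by (blast dest: span_scale_cancel)
    qed
    have 3: "y$0 = 0"
    proof (rule ccontr)
      assume n: "y$0 \<noteq> 0"
      have "y$0 *s p = - (y$3) *s e"
        using eq 1 2 by (simp add: algebra_simps eq_neg_iff_add_eq_0)
      also have "\<dots> \<in> vec.span {e}"
        by (intro vec.span_scale vec.span_base) auto
      finally show False using n assms(2) by (blast dest: span_scale_cancel)
    qed
    have "y$3 = 0" using eq 1 2 3 assms(1) by simp
    with 1 2 3 show "y = 0" by (simp add: vec_eq_iff all_index4)
  qed
  then show ?thesis
    by (simp add: invertible_left_inverse matrix_left_invertible_ker)
qed

text \<open>Repeated arguments make it serve for one or two vectors as well.\<close>

lemma ex_not_in_span: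
  fixes a b c :: "'a::field ^ 4"
  obtains v where "v \<notin> vec.span {a, b, c}"
proof -
  let ?S = "{a, b, c}"
  have "vec.span ?S \<noteq> UNIV"
  proof
    assume eq: "vec.span ?S = UNIV"
    have "vec.dim (vec.span ?S) \<le> card ?S"
      by (simp add: vec.dim_le_card')
    also have "\<dots> < 4" by (simp add: card_insert_if)
    finally have "vec.dim (vec.span ?S) < 4" .
    moreover have "vec.dim (vec.span ?S) = 4"
      unfolding eq vec_dim_card by simp
    ultimately show False by simp
  qed
  then show ?thesis using that by blast
qed

section \<open>Isotropic vectors over a finite field\<close>

lemma card_le_double_card_image:
  assumes "finite A" "\<And>y. y \<in> f ` A \<Longrightarrow> card {x \<in> A. f x = y} \<le> 2"
  shows "card A \<le> 2 * card (f ` A)"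
proof -
  have "card A = card (\<Union>y\<in>f ` A. {x \<in> A. f x = y})"
    by (rule arg_cong[of _ _ card]) auto
  also have "\<dots> \<le> (\<Sum>y\<in>f ` A. card {x \<in> A. f x = y})"
    using assms(1) by (intro card_UN_le) simp
  also have "\<dots> \<le> (\<Sum>y\<in>f ` A. 2)"
    using assms(2) by (intro sum_mono) auto
  finally show ?thesis by simp
qed

lemma card_quadratic_fibre_le:
  fixes a b d :: "'a :: field"
  assumes "a \<noteq> 0"
  shows "card {x \<in> A. a * x\<^sup>2 + d * x + b = y} \<le> 2"
proof (cases "\<exists>z. a * z\<^sup>2 + d * z + b = y")
  case True
  then obtain z where z: "a * z\<^sup>2 + d * z + b = y" by blast
  \<comment> \<open>Vieta: the two solutions add up to \<open>- d / a\<close>.\<close>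
  have "x = z \<or> x = - z - d / a" if "a * x\<^sup>2 + d * x + b = y" for x
  proof -
    have "(x - z) * (a * (x + z) + d) = (a * x\<^sup>2 + d * x + b) - (a * z\<^sup>2 + d * z + b)"
      by (simp add: algebra_simps power2_eq_square)
    also have "\<dots> = 0" using that z by simp
    finally consider "x - z = 0" | "a * (x + z) + d = 0" by (auto simp only: mult_eq_0_iff)
    then show ?thesis
    proof cases
      case 2
      have "a * (x - (- z - d / a)) = a * (x + z) + d" using assms by (simp add: algebra_simps)
      with 2 assms have "x - (- z - d / a) = 0" by (metis mult_eq_0_iff)
      then show ?thesis by simp
    qed simp
  qed
  then have "{x \<in> A. a * x\<^sup>2 + d * x + b = y} \<subseteq> {z, - z - d / a}" by blast
  then have "card {x \<in> A. a * x\<^sup>2 + d * x + b = y} \<le> card {z, - z - d / a}"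
    by (intro card_mono) auto
  also have "\<dots> \<le> 2" by (simp add: card_insert_if)
  finally show ?thesis .
next
  case False
  then have "{x \<in> A. a * x\<^sup>2 + d * x + b = y} = {}" by blast
  then show ?thesis by (simp only: card.empty)
qed

text \<open>Zero discriminant means a degenerate form. If 2 is invertible,
  \<open>(- d, 2 * a)\<close> lies in the radical of the polar form. In characteristic 2 the
  hypothesis says \<open>d = 0\<close>, and \<open>- b / a\<close> is a square because squaring is
  injective, hence surjective, on a finite field.\<close>

lemma binary_isotropic:
  fixes a b d :: "'a :: {field, finite}"
  assumes "a \<noteq> 0" "4 * a * b = d\<^sup>2"
  shows "\<exists>x y. (x, y) \<noteq> (0, 0) \<and> a * x\<^sup>2 + b * y\<^sup>2 + d * x * y = 0"
proof (cases "(2 :: 'a) = 0")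
  case True
  have "inj (\<lambda>x :: 'a. x\<^sup>2)"
  proof (rule injI)
    fix x y :: 'a assume "x\<^sup>2 = y\<^sup>2"
    then have "(x - y)\<^sup>2 = 2 * (y\<^sup>2 - x * y)"
      by (simp add: power2_eq_square algebra_simps)
    with True show "x = y" by simp
  qed
  then have "surj (\<lambda>x :: 'a. x\<^sup>2)"
    by (intro finite_UNIV_inj_surj) auto
  then obtain s where "- b / a = s\<^sup>2" by (metis surjD)
  then have "a * s\<^sup>2 + b = 0"
    using assms(1) by (metis add.left_inverse nonzero_mult_div_cancel_left times_divide_eq_right)
  moreover have "(4 :: 'a) = 2 * 2" by simp
  then have "d = 0" using assms(2) True by simp
  ultimately show ?thesis by (intro exI[of _ s] exI[of _ 1]) simp
next
  case False
  have "a * (- d)\<^sup>2 + b * (2 * a)\<^sup>2 + d * (- d) * (2 * a) = a * (4 * a * b - d\<^sup>2)"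
    by (simp add: power2_eq_square algebra_simps)
  with False assms show ?thesis by (intro exI[of _ "- d"] exI[of _ "2 * a"]) simp
qed

text \<open>If the first two variables span a nondegenerate binary form, then completing the square
  leaves \<open>F (s + t \<alpha>, 1 + t \<beta>, t) = (a s\<^sup>2 + d s + b) + C t\<^sup>2\<close>, and the values of the two
  quadratic polynomials are too many to avoid each other's negatives.\<close>

lemma ternary_isotropic:
  fixes a b c d e g :: "'a :: {field, finite}"
  shows "\<exists>x y z. (x, y, z) \<noteq> (0, 0, 0) \<and>
    a * x\<^sup>2 + b * y\<^sup>2 + c * z\<^sup>2 + d * x * y + e * x * z + g * y * z = 0"
proof -
  define F where "F = (\<lambda>x y z. a * x\<^sup>2 + b * y\<^sup>2 + c * z\<^sup>2 + d * x * y + e * x * z + g * y * z)"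
  have "\<exists>x y z. (x, y, z) \<noteq> (0, 0, 0) \<and> F x y z = 0"
  proof -
    consider "a = 0" | "a \<noteq> 0" "4 * a * b = d\<^sup>2" | "a \<noteq> 0" "4 * a * b \<noteq> d\<^sup>2" by blast
    then show ?thesis
    proof cases
      case 1
      then show ?thesis by (intro exI[of _ 1] exI[of _ 0]) (simp add: F_def)
    next
      case 2
      then obtain x y where "(x, y) \<noteq> (0, 0)" "a * x\<^sup>2 + b * y\<^sup>2 + d * x * y = 0"
        using binary_isotropic by metis
      then show ?thesis by (intro exI[of _ x] exI[of _ y] exI[of _ 0]) (simp add: F_def)
    next
      case 3
      define D where "D = 4 * a * b - d\<^sup>2"
      have D: "D \<noteq> 0" using 3 by (simp add: D_def)
      \<comment> \<open>Cramer's rule for the linear system \<open>ab\<close> with determinant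
        \<open>D\<close>. It moves the centre of the form so that all terms linear in
        \<open>t\<close> disappear.\<close>
      define \<alpha> where "\<alpha> = (d * g - 2 * b * e) / D"
      define \<beta> where "\<beta> = (d * e - 2 * a * g) / D"
      have "(2 * a * \<alpha> + d * \<beta> + e) * D = 0" "(d * \<alpha> + 2 * b * \<beta> + g) * D = 0"
        using D unfolding \<alpha>_def \<beta>_def
        by (simp_all add: distrib_right distrib_left) (simp_all add: D_def algebra_simps power2_eq_square)
      then have ab: "2 * a * \<alpha> + d * \<beta> + e = 0" "d * \<alpha> + 2 * b * \<beta> + g = 0"
        using D by simp_all
      define C where "C = F \<alpha> \<beta> 1"
      have "F (s + t * \<alpha>) (1 + t * \<beta>) t =
          (a * s\<^sup>2 + d * s + b) + C * t\<^sup>2 + s * t * (2 * a * \<alpha> + d * \<beta> + e)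
          + t * (d * \<alpha> + 2 * b * \<beta> + g)" for s t
        by (simp add: C_def F_def power2_eq_square algebra_simps)
      then have F: "F (s + t * \<alpha>) (1 + t * \<beta>) t = (a * s\<^sup>2 + d * s + b) + C * t\<^sup>2" for s t
        by (simp add: ab)
      show ?thesis
      proof (cases "C = 0")
        case True
        then show ?thesis unfolding C_def by (intro exI[of _ \<alpha>] exI[of _ \<beta>] exI[of _ 1]) simp
      next
        case False
        let ?G = "range (\<lambda>s. a * s\<^sup>2 + d * s + b)"
        let ?H = "range (\<lambda>t. (- C) * t\<^sup>2 + 0 * t + 0)"
        \<comment> \<open>Treating \<open>t = 0\<close> apart gains the strict inequality: 0 has
          only one preimage, so \<open>?H\<close> has at least (q + 1)/2 elements, while
          \<open>?G\<close> has at least q/2.\<close>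
        let ?H' = "(\<lambda>t. (- C) * t\<^sup>2 + 0 * t + 0) ` (UNIV - {0})"
        have G: "CARD('a) \<le> 2 * card ?G"
          using \<open>a \<noteq> 0\<close> card_quadratic_fibre_le[of a UNIV d b] by (intro card_le_double_card_image) auto
        have "card (UNIV - {0 :: 'a}) \<le> 2 * card ?H'"
          using False card_quadratic_fibre_le[of "- C" "UNIV - {0}" 0 0]
          by (intro card_le_double_card_image) auto
        moreover have "?H = insert 0 ?H'" "0 \<notin> ?H'" using False by (auto simp: image_iff)
        then have "card ?H = Suc (card ?H')" by simp
        ultimately have H: "CARD('a) < 2 * card ?H" by (simp add: card_Diff_singleton)
        have "?G \<inter> ?H \<noteq> {}"
        proof
          assume "?G \<inter> ?H = {}"
          then have "card (?G \<union> ?H) = card ?G + card ?H" by (intro card_Un_disjoint) auto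
          moreover have "card (?G \<union> ?H) \<le> CARD('a)" by (intro card_mono) auto
          ultimately show False using G H by linarith
        qed
        then obtain s t where "a * s\<^sup>2 + d * s + b = (- C) * t\<^sup>2 + 0 * t + 0" by blast
        then have "F (s + t * \<alpha>) (1 + t * \<beta>) t = 0" by (simp add: F)
        moreover have "(s + t * \<alpha>, 1 + t * \<beta>, t) \<noteq> (0, 0, 0)" by auto
        ultimately show ?thesis by blast
      qed
    qed
  qed
  then show ?thesis by (simp add: F_def)
qed

section \<open>Splitting off a hyperbolic pair\<close>

lemma quad_form_comb:
  assumes f: "f \<in> quad_forms"
  shows "f (a *s p + b *s u + c *s r + d *s e) =
    a\<^sup>2 * f p + b\<^sup>2 * f u + c\<^sup>2 * f r + d\<^sup>2 * f e + a * b * polar f p u + a * c * polar f p r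
    + b * c * polar f u r + a * d * polar f p e + b * d * polar f u e + c * d * polar f r e"
  by (simp add: quad_form_add[of f] quad_form_scale[OF f] polar_add_left[OF f] polar_scale_left[OF f]
      polar_add_right[OF f] polar_scale_right[OF f] algebra_simps)

lemma span_singleton_iff: "x \<in> vec.span {e} \<longleftrightarrow> (\<exists>k. x = k *s e)"
  by (auto simp: vec.span_singleton)

lemma span_pair_iff: "x \<in> vec.span {p, e} \<longleftrightarrow> (\<exists>k m. x = k *s p + m *s e)"
proof -
  have "x \<in> vec.span {p, e} \<longleftrightarrow> (\<exists>k m. x - k *s p = m *s e)"
    by (auto simp: vec.span_insert[of p "{e}"] span_singleton_iff)
  then show ?thesis by (simp add: algebra_simps)
qed

text \<open>Keeps the isotropic vector, which is found in a complement of the radical direction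
  \<open>e\<close>, off the line of \<open>e\<close>.\<close>

lemma independent_triple_nonzero:
  fixes e :: "'a::field ^ 4"
  assumes "u \<notin> vec.span {e}" "v \<notin> vec.span {u, e}" "w \<notin> vec.span {v, u, e}"
    and "(x, y, z) \<noteq> (0, 0, 0)"
  shows "x *s u + y *s v + z *s w \<notin> vec.span {e}"
proof
  assume "x *s u + y *s v + z *s w \<in> vec.span {e}"
  then have s: "x *s u + y *s v + z *s w \<in> vec.span (insert a (insert b {e}))"
    "x *s u + y *s v + z *s w \<in> vec.span (insert a {e})" "x *s u + y *s v + z *s w \<in> vec.span {e}" for a b
    by (meson vec.span_mono subset_insertI in_mono order_trans)+
  have z: "z = 0"
  proof (rule ccontr)
    assume "z \<noteq> 0"
    have "(x *s u + y *s v + z *s w) - x *s u - y *s v \<in> vec.span {v, u, e}"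
      by (intro vec.span_diff s vec.span_scale vec.span_base) auto
    then show False using \<open>z \<noteq> 0\<close> assms(3) span_scale_cancel by force
  qed
  have y: "y = 0"
  proof (rule ccontr)
    assume "y \<noteq> 0"
    have "(x *s u + y *s v + z *s w) - x *s u \<in> vec.span {u, e}"
      by (intro vec.span_diff s vec.span_scale vec.span_base) auto
    then show False using \<open>y \<noteq> 0\<close> z assms(2) span_scale_cancel by force
  qed
  have "x = 0"
    using s(3) y z assms(1) span_scale_cancel by force
  with y z assms(4) show False by simp
qed

text \<open>Beyond the radical direction \<open>e\<close> a ternary form remains. It has an
  isotropic vector \<open>p\<close>, which is completed to a hyperbolic pair \<open>p\<close>,
  \<open>r\<close>, and \<open>u\<close> is taken orthogonal to both. That the rank is not smaller
  than 3 is used twice: to keep \<open>p\<close> out of the radical and to make \<open>f u\<close>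
  nonzero.\<close>

lemma cone_normal_form:
  fixes f :: "'a::{field,finite} ^ 4 \<Rightarrow> 'a"
  assumes f: "f \<in> quad_forms" and rank: "form_rank f = 3"
  obtains A :: "'a ^ 4 ^ 4" and c where "invertible A" "c \<noteq> 0" "\<And>y. f (A *v y) = c * (y$0 * y$2 - (y$1)\<^sup>2)"
proof -
  obtain e where e: "e \<noteq> 0" "\<And>x t. f (x + t *s e) = f x"
    using form_rank_less_4_imp_radical[OF f] rank by auto
  have fe: "f e = 0" using e(2)[of 0 1] quad_form_0[OF f] by simp
  have pe: "polar f x e = 0" for x using e(2)[of x 1] fe by (simp add: polar_def)
  have pe': "polar f e x = 0" for x using pe[of x] polar_commute[of f e x] by simp
  obtain u0 where u0: "u0 \<notin> vec.span {e}" using ex_not_in_span[of e e e] by auto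
  obtain v0 where v0: "v0 \<notin> vec.span {u0, e}"
    using ex_not_in_span[of u0 e e] by auto
  obtain w0 where w0: "w0 \<notin> vec.span {v0, u0, e}"
    using ex_not_in_span[of v0 u0 e] by auto
  obtain x y z where xyz: "(x, y, z) \<noteq> (0, 0, 0)" and
    "f u0 * x\<^sup>2 + f v0 * y\<^sup>2 + f w0 * z\<^sup>2 + polar f u0 v0 * x * y + polar f u0 w0 * x * z + polar f v0 w0 * y * z = 0"
    using ternary_isotropic by metis
  then have "f (x *s u0 + y *s v0 + z *s w0 + 0 *s e) = 0"
    unfolding quad_form_comb[OF f] by (simp add: algebra_simps)
  moreover define p where "p = x *s u0 + y *s v0 + z *s w0"
  ultimately have fp: "f p = 0" by simp
  have p: "p \<notin> vec.span {e}"
    using independent_triple_nonzero[OF u0 v0 w0 xyz] by (simp add: p_def)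
  have "\<exists>r. polar f p r \<noteq> 0"
  proof (rule ccontr)
    \<comment> \<open>An isotropic \<open>p\<close> orthogonal to everything is a second direction
      of invariance besides \<open>e\<close>.\<close>
    assume "\<nexists>r. polar f p r \<noteq> 0"
    then have pp: "polar f p x = 0" "polar f x p = 0" for x using polar_commute[of f x p] by auto
    obtain r where r: "r \<notin> vec.span {p, e}"
      using ex_not_in_span[of p e e] by auto
    obtain u where u: "u \<notin> vec.span {r, p, e}"
      using ex_not_in_span[of r p e] by auto
    have "form_rank f \<le> 4 - card {0, 3 :: 4}"
    proof (rule form_rank_le[OF invertible_frame[OF e(1) p r u]])
      fix k :: 4 and x t assume "k \<in> {0, 3}"
      then show "f (frame p u r e *v (x + t *s axis k 1)) = f (frame p u r e *v x)"
        unfolding frame_mult quad_form_comb[OF f]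
        by (auto simp: pp pe pe' fp fe axis_def)
    qed
    then show False using rank by simp
  qed
  then obtain r0 where r0: "polar f p r0 \<noteq> 0" by blast
  define r1 where "r1 = (1 / polar f p r0) *s r0"
  have r1: "polar f p r1 = 1" using r0 by (simp add: r1_def polar_scale_right[OF f])
  \<comment> \<open>Since \<open>f (r1 + t *s p) = f r1 + t\<close>, this multiple of
    \<open>p\<close> makes \<open>r\<close> isotropic, and \<open>polar f p r\<close> stays
    1.\<close>
  define r where "r = r1 + (- f r1) *s p"
  have ppp: "polar f p p = 0" by (simp add: polar_self[OF f] fp)
  have pr: "polar f p r = 1"
    unfolding r_def polar_add_right[OF f] polar_scale_right[OF f] r1 ppp by simp
  have fr: "f r = 0"
    unfolding r_def quad_form_add[of f] quad_form_scale[OF f] polar_scale_right[OF f] fp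
      polar_commute[of f r1 p] r1 by simp
  have r: "r \<notin> vec.span {p, e}"
  proof
    assume "r \<in> vec.span {p, e}"
    then obtain k m where "r = k *s p + m *s e" by (auto simp: span_pair_iff)
    then have "polar f p r = 0"
      by (simp add: polar_add_right[OF f] polar_scale_right[OF f] ppp pe)
    with pr show False by simp
  qed
  obtain v where v: "v \<notin> vec.span {r, p, e}"
    using ex_not_in_span[of r p e] by auto
  \<comment> \<open>Projects \<open>v\<close> off the hyperbolic pair. The coefficients are crossed
    because \<open>p\<close> and \<open>r\<close> are isotropic with
    \<open>polar f p r = 1\<close>.\<close>
  define u where "u = v + ((- polar f v r) *s p + (- polar f v p) *s r)"
  have u: "u \<notin> vec.span {r, p, e}"
  proof
    assume "u \<in> vec.span {r, p, e}"
    moreover have "(- polar f v r) *s p + (- polar f v p) *s r \<in> vec.span {r, p, e}"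
      by (intro vec.span_add vec.span_scale vec.span_base) auto
    ultimately have "u - ((- polar f v r) *s p + (- polar f v p) *s r) \<in> vec.span {r, p, e}"
      by (rule vec.span_diff)
    then show False using v by (simp add: u_def)
  qed
  have prr: "polar f r r = 0" "polar f r p = 1"
    using pr using polar_commute[of f r p] by (simp_all add: polar_self[OF f] fr)
  have "polar f u p = 0" "polar f u r = 0"
    unfolding u_def polar_add_left[OF f] polar_scale_left[OF f] ppp pr prr
    by simp_all
  then have up: "polar f p u = 0" "polar f u r = 0"
    using polar_commute[of f p u] by simp_all
  \<comment> \<open>Scaling \<open>r\<close> by \<open>c\<close> gives the product term the
    coefficient \<open>c\<close>, and the square has the coefficient \<open>f u = - c\<close>; so
    \<open>c\<close> becomes a common factor, which does not affect the zero set.\<close>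
  define c where "c = - f u"
  have c: "c \<noteq> 0"
  proof
    assume "c = 0"
    have "form_rank f \<le> 4 - card {1, 3 :: 4}"
    proof (rule form_rank_le[OF invertible_frame[OF e(1) p r u]])
      fix k :: 4 and x t assume "k \<in> {1, 3}"
      then show "f (frame p u r e *v (x + t *s axis k 1)) = f (frame p u r e *v x)"
        unfolding frame_mult quad_form_comb[OF f] using \<open>c = 0\<close>
        by (auto simp: pe pe' up fp fe fr axis_def c_def)
    qed
    then show False using rank by simp
  qed
  have "c *s r \<notin> vec.span {p, e}" using r c span_scale_cancel by blast
  moreover have "vec.span {c *s r, p, e} \<subseteq> vec.span {r, p, e}"
    by (intro vec.span_minimal vec.subspace_span) (auto intro: vec.span_scale vec.span_base)
  then have "u \<notin> vec.span {c *s r, p, e}" using u by blast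
  ultimately have "invertible (frame p u (c *s r) e)"
    using invertible_frame[OF e(1) p] by blast
  moreover have "f (frame p u (c *s r) e *v y) = c * (y$0 * y$2 - (y$1)\<^sup>2)" for y
    unfolding frame_mult quad_form_comb[OF f] polar_scale_right[OF f] polar_scale_left[OF f]
      quad_form_scale[OF f] pe pe' up fp fe fr pr
    by (simp add: c_def algebra_simps)
  ultimately show ?thesis using that c by blast
qed

subsection \<open>Binary forms\<close>

text \<open>Homogeneous forms of degree \<open>n\<close> in Horner style. They are functions, since
  only values on the cone matter; the zero function belongs to every degree.\<close>

fun binary_form :: "nat \<Rightarrow> ('a::field \<Rightarrow> 'a \<Rightarrow> 'a) \<Rightarrow> bool" where
  "binary_form 0 F \<longleftrightarrow> (\<exists>c. \<forall>s t. F s t = c)"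
| "binary_form (Suc n) F \<longleftrightarrow> (\<exists>G c. binary_form n G \<and> (\<forall>s t. F s t = s * G s t + c * t ^ Suc n))"

lemma binary_form_uminus:
  "binary_form n F \<Longrightarrow> binary_form n (\<lambda>s t. - F s t)"
proof (induction n arbitrary: F)
  case (Suc n)
  then obtain G c where G: "binary_form n G" "\<And>s t. F s t = s * G s t + c * t ^ Suc n" by auto
  then have "binary_form n (\<lambda>s t. - G s t)" using Suc.IH by blast
  moreover have "- F s t = s * - G s t + (- c) * t ^ Suc n" for s t
    by (simp add: G)
  ultimately show ?case unfolding binary_form.simps by blast
qed auto

text \<open>Division with remainder by \<open>s - z * t\<close>. The remainder is a multiple of a
  power of \<open>t\<close>, so its coefficient is the value of \<open>F\<close> at
  \<open>(z, 1)\<close>.\<close>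

lemma binary_form_div_left:
  "binary_form (Suc n) F \<Longrightarrow> \<exists>G c. binary_form n G \<and> (\<forall>s t. F s t = (s - z * t) * G s t + c * t ^ Suc n)"
proof (induction n arbitrary: F)
  case 0
  then obtain k c where "\<And>s t. F s t = s * k + c * t" by auto
  then have "\<forall>s t. F s t = (s - z * t) * (\<lambda>s t. k) s t + (c + z * k) * t ^ Suc 0"
    by (simp add: algebra_simps)
  moreover have "binary_form 0 (\<lambda>s t. k)" by simp
  ultimately show ?case by blast
next
  case (Suc n)
  then obtain G' c where G': "binary_form (Suc n) G'" "\<And>s t. F s t = s * G' s t + c * t ^ Suc (Suc n)"
    by (metis binary_form.simps(2))
  then obtain G k where G: "binary_form n G" "\<And>s t. G' s t = (s - z * t) * G s t + k * t ^ Suc n"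
    using Suc.IH by blast
  have "\<forall>s t. F s t = (s - z * t) * (s * G s t + k * t ^ Suc n) + (c + z * k) * t ^ Suc (Suc n)"
    by (simp add: G' G algebra_simps)
  moreover have "binary_form (Suc n) (\<lambda>s t. s * G s t + k * t ^ Suc n)"
    using G(1) by auto
  ultimately show ?case by blast
qed

text \<open>The counterpart for the point at infinity \<open>(1, 0)\<close>, where the divisor is
  \<open>t\<close>.\<close>

lemma binary_form_div_right:
  "binary_form (Suc n) F \<Longrightarrow> \<exists>G c. binary_form n G \<and> (\<forall>s t. F s t = t * G s t + c * s ^ Suc n)"
proof (induction n arbitrary: F)
  case 0
  then obtain k c where "\<And>s t. F s t = s * k + c * t" by auto
  then have "\<forall>s t. F s t = t * (\<lambda>s t. c) s t + k * s ^ Suc 0"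
    by (simp add: algebra_simps)
  moreover have "binary_form 0 (\<lambda>s t. c)" by simp
  ultimately show ?case by blast
next
  case (Suc n)
  then obtain G' c where G': "binary_form (Suc n) G'" "\<And>s t. F s t = s * G' s t + c * t ^ Suc (Suc n)"
    by (metis binary_form.simps(2))
  then obtain G k where G: "binary_form n G" "\<And>s t. G' s t = t * G s t + k * s ^ Suc n"
    using Suc.IH by blast
  have "\<forall>s t. F s t = t * (s * G s t + c * t ^ Suc n) + k * s ^ Suc (Suc n)"
    by (simp add: G' G algebra_simps)
  moreover have "binary_form (Suc n) (\<lambda>s t. s * G s t + c * t ^ Suc n)"
    using G(1) by auto
  ultimately show ?case by blast
qed

text \<open>Points of the projective line, normalized to \<open>(s, 1)\<close> or \<open>(1, 0)\<close>.\<close>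

definition dirs :: "('a::field \<times> 'a) set" where
  "dirs = insert (1, 0) ((\<lambda>s. (s, 1)) ` UNIV)"

text \<open>The determinant of \<open>(s, t)\<close> and \<open>r\<close>, hence a linear form whose
  only root in \<open>dirs\<close> is \<open>r\<close> if \<open>r\<close> itself is there.\<close>

definition lin :: "'a::field \<times> 'a \<Rightarrow> 'a \<Rightarrow> 'a \<Rightarrow> 'a" where
  "lin r s t = snd r * s - fst r * t"

lemma card_dirs: "card (dirs :: ('a::{field,finite} \<times> 'a) set) = CARD('a) + 1"
proof -
  have "card ((\<lambda>s :: 'a. (s, 1 :: 'a)) ` UNIV) = CARD('a)"
    by (intro card_image) (auto simp: inj_on_def)
  moreover have "(1, 0) \<notin> (\<lambda>s :: 'a. (s, 1 :: 'a)) ` UNIV" by auto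
  ultimately show ?thesis unfolding dirs_def by simp
qed

lemma lin_eq_0_iff:
  assumes "r \<in> dirs" "r' \<in> dirs"
  shows "lin r (fst r') (snd r') = 0 \<longleftrightarrow> r = r'"
  using assms by (auto simp: dirs_def lin_def)

lemma binary_form_factor:
  assumes "binary_form (Suc n) F" "r \<in> dirs" "F (fst r) (snd r) = 0"
  obtains G where "binary_form n G" "\<And>s t. F s t = lin r s t * G s t"
proof (cases "r = (1, 0)")
  case True
  obtain G c where G: "binary_form n G" "\<And>s t. F s t = t * G s t + c * s ^ Suc n"
    using binary_form_div_right[OF assms(1)] by blast
  with assms(3) True have "c = 0" by simp
  then have "\<And>s t. F s t = lin r s t * - G s t"
    by (simp add: G True lin_def)
  then show ?thesis using that[OF binary_form_uminus[OF G(1)]] by blast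
next
  case False
  then obtain z where z: "r = (z, 1)" using assms(2) by (auto simp: dirs_def)
  obtain G c where G: "binary_form n G" "\<And>s t. F s t = (s - z * t) * G s t + c * t ^ Suc n"
    using binary_form_div_left[OF assms(1)] by blast
  with assms(3) z have "c = 0" by simp
  then have "\<And>s t. F s t = lin r s t * G s t"
    by (simp add: G z lin_def)
  then show ?thesis using that[OF G(1)] by blast
qed

definition roots :: "('a::field \<Rightarrow> 'a \<Rightarrow> 'a) \<Rightarrow> ('a \<times> 'a) set" where
  "roots F = {r \<in> dirs. F (fst r) (snd r) = 0}"

text \<open>The usual bound on the number of roots: splitting off \<open>lin r\<close> loses at most
  the root \<open>r\<close>.\<close>

lemma binary_form_eq_0:
  fixes F :: "'a::{field,finite} \<Rightarrow> 'a \<Rightarrow> 'a"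
  assumes "binary_form n F" "n < card (roots F)"
  shows "F s t = 0"
  using assms
proof (induction n arbitrary: F s t)
  case 0
  then obtain c where c: "\<And>s t. F s t = c" by auto
  have "roots F \<noteq> {}" using 0 by auto
  then show ?case using c by (auto simp: roots_def)
next
  case (Suc n)
  have "roots F \<noteq> {}" using Suc.prems by auto
  then obtain r where r: "r \<in> dirs" "F (fst r) (snd r) = 0" by (auto simp: roots_def)
  obtain G where G: "binary_form n G" "\<And>s t. F s t = lin r s t * G s t"
    using binary_form_factor[OF Suc.prems(1) r] by blast
  have "roots F \<subseteq> insert r (roots G)"
  proof
    fix x assume x: "x \<in> roots F"
    then have "lin r (fst x) (snd x) = 0 \<or> G (fst x) (snd x) = 0" "x \<in> dirs"
      by (simp_all add: roots_def G(2))
    then show "x \<in> insert r (roots G)"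
      using lin_eq_0_iff[OF r(1), of x] by (auto simp: roots_def)
  qed
  then have "card (roots F) \<le> card (insert r (roots G))"
    by (intro card_mono) auto
  also have "\<dots> \<le> Suc (card (roots G))" by (simp add: card_insert_if)
  finally have "n < card (roots G)" using Suc.prems by simp
  then show ?case using Suc.IH[OF G(1)] by (simp add: G(2))
qed

lemma binary_form_1_root:
  assumes "binary_form (Suc 0) F"
  obtains r where "r \<in> dirs" "F (fst r) (snd r) = 0"
proof -
  obtain k c where F: "\<And>s t. F s t = s * k + c * t" using assms by auto
  show ?thesis
  proof (cases "k = 0")
    case True
    then show ?thesis using that[of "(1, 0)"] by (simp add: F dirs_def)
  next
    case False
    then show ?thesis using that[of "(- c / k, 1)"] by (simp add: F dirs_def)
  qed
qed

text \<open>Splitting off the three roots leaves a linear form. It has a root, which is also a root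
  of \<open>F\<close> and therefore repeats one of the three; the repeated one is called
  \<open>r1\<close>.\<close>

lemma quartic_with_three_roots:
  fixes F :: "'a::{field,finite} \<Rightarrow> 'a \<Rightarrow> 'a"
  assumes F: "binary_form 4 F" and card: "card (roots F) = 3"
  obtains r1 r2 r3 k where "r1 \<in> dirs" "r2 \<in> dirs" "r3 \<in> dirs" "r1 \<noteq> r2" "r1 \<noteq> r3" "r2 \<noteq> r3"
    "\<And>s t. F s t = k * (lin r1 s t * lin r2 s t) * (lin r1 s t * lin r3 s t)"
proof -
  obtain a b c where abc: "roots F = {a, b, c}" "a \<noteq> b" "a \<noteq> c" "b \<noteq> c"
    using card by (auto simp: card_3_iff)
  have d: "a \<in> dirs" "b \<in> dirs" "c \<in> dirs"
    and z: "F (fst a) (snd a) = 0" "F (fst b) (snd b) = 0" "F (fst c) (snd c) = 0"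
    using abc(1) by (auto simp: roots_def)
  have "binary_form (Suc 3) F" using F by (simp add: numeral_eq_Suc)
  then obtain G1 where G1: "binary_form 3 G1" "\<And>s t. F s t = lin a s t * G1 s t"
    using binary_form_factor d(1) z(1) by blast
  have "G1 (fst b) (snd b) = 0" using z(2) abc lin_eq_0_iff[OF d(1,2)] by (simp add: G1(2))
  moreover have "binary_form (Suc 2) G1" using G1(1) by (simp add: numeral_eq_Suc)
  ultimately obtain G2 where G2: "binary_form 2 G2" "\<And>s t. G1 s t = lin b s t * G2 s t"
    using binary_form_factor d(2) by blast
  have "G2 (fst c) (snd c) = 0"
    using z(3) abc lin_eq_0_iff[OF d(1,3)] lin_eq_0_iff[OF d(2,3)] by (simp add: G1(2) G2(2))
  moreover have "binary_form (Suc 1) G2" using G2(1) by (simp add: numeral_eq_Suc)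
  ultimately obtain G3 where G3: "binary_form (Suc 0) G3" "\<And>s t. G2 s t = lin c s t * G3 s t"
    using binary_form_factor[of 1 G2 c] d(3) by (metis One_nat_def)
  obtain r where r: "r \<in> dirs" "G3 (fst r) (snd r) = 0"
    using binary_form_1_root[OF G3(1)] by blast
  obtain G4 where G4: "binary_form 0 G4" "\<And>s t. G3 s t = lin r s t * G4 s t"
    using binary_form_factor[OF G3(1) r] by blast
  obtain k where k: "\<And>s t. G4 s t = k" using G4(1) by auto
  have eq: "F s t = k * lin r s t * lin a s t * lin b s t * lin c s t" for s t
    by (simp add: G1(2) G2(2) G3(2) G4(2) k)
  have "r \<in> roots F" using r(1) lin_eq_0_iff[OF r(1) r(1)] by (simp add: roots_def eq)
  then consider "r = a" | "r = b" | "r = c" using abc(1) by auto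
  then show ?thesis
  proof cases
    case 1
    then show ?thesis using that[of a b c k] d abc eq by simp
  next
    case 2
    then show ?thesis using that[of b a c k] d abc eq by simp
  next
    case 3
    then show ?thesis using that[of c a b k] d abc eq by simp
  qed
qed

subsection \<open>Generators and vertex\<close>

definition vec4 :: "'a::field \<Rightarrow> 'a \<Rightarrow> 'a \<Rightarrow> 'a \<Rightarrow> 'a ^ 4" where
  "vec4 a b c d = (\<chi> i. if i = 0 then a else if i = 1 then b else if i = 2 then c else d)"

lemma vec4_nth [simp]: "vec4 a b c d $ 0 = a" "vec4 a b c d $ 1 = b" "vec4 a b c d $ 2 = c" "vec4 a b c d $ 3 = d"
  by (simp_all add: vec4_def)

lemma vec4_eqI:
  fixes x y :: "'a::field ^ 4"
  assumes "x$0 = y$0" "x$1 = y$1" "x$2 = y$2" "x$3 = y$3"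
  shows "x = y"
  using assms by (simp add: vec_eq_iff all_index4)

lemma vec4_inject [simp]: "vec4 a b c d = vec4 a' b' c' d' \<longleftrightarrow> a = a' \<and> b = b' \<and> c = c' \<and> d = d'"
  by (metis vec4_nth)

lemma vec4_add: "vec4 a b c d + vec4 a' b' c' d' = vec4 (a + a') (b + b') (c + c') (d + d')"
  by (rule vec4_eqI) simp_all

lemma vec4_scale: "k *s vec4 a b c d = vec4 (k * a) (k * b) (k * c) (k * d)"
  by (rule vec4_eqI) simp_all

lemma vec4_zero: "0 = vec4 0 0 0 0"
  by (rule vec4_eqI) simp_all

lemma Int_PG3_subset_imp_subset:
  fixes U V :: "('a::field ^ 4) set"
  assumes "vec.subspace U" "vec.subspace V" "U \<inter> PG3 \<subseteq> V"
  shows "U \<subseteq> V"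
proof
  fix x assume x: "x \<in> U"
  show "x \<in> V"
  proof (cases "x = 0")
    case False
    then obtain k where k: "k \<noteq> 0" "k *s x \<in> PG3" using PG3_scale_exists by blast
    have "k *s x \<in> V" using k(2) x assms vec.subspace_scale by blast
    then have "inverse k *s (k *s x) \<in> V" using assms(2) vec.subspace_scale by blast
    then show ?thesis using k(1) by simp
  qed (use assms(2) vec.subspace_0 in simp)
qed

text \<open>\<open>B\<close> takes a vector to its coordinates in the normal form, and
  \<open>A\<close> takes it back. Normalization still refers to the original coordinates, which is
  why points are passed through \<open>pnorm\<close> below.\<close>

locale cone_coordinates =
  fixes A B :: "'a::{field,finite} ^ 4 ^ 4" and X :: "('a ^ 4) set"
  assumes AB: "A ** B = mat 1" and BA: "B ** A = mat 1"
    and X_eq: "X = {x \<in> PG3. (B *v x)$0 * (B *v x)$2 = ((B *v x)$1)\<^sup>2}"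
begin

lemma B_A [simp]: "B *v (A *v x) = x"
  by (simp add: matrix_vector_mul_assoc BA)

lemma A_B [simp]: "A *v (B *v x) = x"
  by (simp add: matrix_vector_mul_assoc AB)

lemma A_inject: "A *v x = A *v y \<longleftrightarrow> x = y"
  by (metis B_A)

text \<open>The cone equation on all vectors, zero included, so that it can be tested on whole
  subspaces.\<close>

definition singular :: "'a ^ 4 \<Rightarrow> bool" where
  "singular x \<longleftrightarrow> (B *v x)$0 * (B *v x)$2 = ((B *v x)$1)\<^sup>2"

lemma mem_X_iff: "x \<in> X \<longleftrightarrow> x \<in> PG3 \<and> singular x"
  by (simp add: X_eq singular_def)

lemma singular_scale: "singular x \<Longrightarrow> singular (k *s x)"
  by (simp add: singular_def vector_scalar_commute power2_eq_square)

text \<open>The point with parameters \<open>r = (s, t)\<close> on the conic and \<open>w\<close> on the generator; \<open>k = 0\<close> is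
  the vertex.\<close>

definition pt :: "'a \<times> 'a \<Rightarrow> 'a \<Rightarrow> 'a \<Rightarrow> 'a ^ 4" where
  "pt r k w = A *v vec4 (k * (fst r)\<^sup>2) (k * (fst r * snd r)) (k * (snd r)\<^sup>2) w"

lemma pt_add: "pt r k w + pt r k' w' = pt r (k + k') (w + w')"
  by (simp add: pt_def matrix_vector_right_distrib[symmetric] vec4_add distrib_right)

lemma pt_scale: "m *s pt r k w = pt r (m * k) (m * w)"
  by (simp add: pt_def vector_scalar_commute[symmetric] vec4_scale mult.assoc)

lemma pt_0: "pt r 0 w = pt r' 0 w"
  by (simp add: pt_def)

lemma pt_0_0: "pt r 0 0 = 0"
  by (simp add: pt_def vec4_zero[symmetric])

lemma pt_eq_iff:
  assumes "r \<in> dirs" "r' \<in> dirs"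
  shows "pt r k w = pt r' k' w' \<longleftrightarrow> w = w' \<and> k = k' \<and> (k = 0 \<or> r = r')"
  using assms by (auto simp: pt_def A_inject dirs_def)

lemma singular_pt: "singular (pt r k w)"
  by (simp add: singular_def pt_def power2_eq_square)

definition ruling :: "'a \<times> 'a \<Rightarrow> ('a ^ 4) set" where
  "ruling r = {x. \<exists>k w. x = pt r k w}"

lemma pt_in_ruling: "pt r k w \<in> ruling r"
  by (auto simp: ruling_def)

lemma subspace_ruling: "vec.subspace (ruling r)"
proof (rule vec.subspaceI)
  show "0 \<in> ruling r" using pt_0_0[of r] pt_in_ruling by metis
next
  fix x y c assume "x \<in> ruling r" "y \<in> ruling r"
  then show "x + y \<in> ruling r" unfolding ruling_def using pt_add by blast
next
  fix c x assume "x \<in> ruling r"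
  then show "c *s x \<in> ruling r" unfolding ruling_def using pt_scale by blast
qed

lemma ruling_inter:
  assumes "r \<in> dirs" "r' \<in> dirs" "r \<noteq> r'" "x \<in> ruling r" "x \<in> ruling r'"
  shows "\<exists>w. x = pt r 0 w"
  using assms by (auto simp: ruling_def pt_eq_iff)

lemma singular_iff: "singular x \<longleftrightarrow> (\<exists>r\<in>dirs. x \<in> ruling r)"
proof
  assume "\<exists>r\<in>dirs. x \<in> ruling r"
  then show "singular x" by (auto simp: ruling_def singular_pt)
next
  assume x: "singular x"
  define y where "y = B *v x"
  have y: "y$0 * y$2 = (y$1)\<^sup>2" using x by (simp add: singular_def y_def)
  have xy: "x = A *v y" by (simp add: y_def)
  show "\<exists>r\<in>dirs. x \<in> ruling r"
  proof (cases "y$2 = 0")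
    case True
    then have "y = vec4 (y$0) 0 0 (y$3)" using y by (intro vec4_eqI) simp_all
    then have "x = pt (1, 0) (y$0) (y$3)" by (simp add: xy pt_def)
    then show ?thesis by (auto simp: ruling_def dirs_def)
  next
    case False
    then have "y = vec4 (y$2 * (y$1 / y$2)\<^sup>2) (y$2 * (y$1 / y$2 * 1)) (y$2 * 1\<^sup>2) (y$3)"
      using y by (intro vec4_eqI) (simp_all add: power2_eq_square field_simps)
    then have "x = pt (y$1 / y$2, 1) (y$2) (y$3)" unfolding xy pt_def by simp
    moreover have "(y$1 / y$2, 1) \<in> dirs" by (simp add: dirs_def)
    ultimately show ?thesis using pt_in_ruling by blast
  qed
qed

text \<open>At the sum of two singular vectors the cone form takes the value of its polar form,
  which here is \<open>k * k'\<close> times the square of the determinant of the two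
  directions.\<close>

lemma singular_add_pt:
  assumes "r \<in> dirs" "r' \<in> dirs" "r \<noteq> r'" "singular (pt r k w + pt r' k' w')"
  shows "k = 0 \<or> k' = 0"
proof -
  obtain s t s' t' where [simp]: "r = (s, t)" "r' = (s', t')" by fastforce
  have "(k * s\<^sup>2 + k' * s'\<^sup>2) * (k * t\<^sup>2 + k' * t'\<^sup>2) = (k * (s * t) + k' * (s' * t'))\<^sup>2"
    using assms(4) by (simp add: singular_def pt_def matrix_vector_right_distrib)
  then have "0 = (k * s\<^sup>2 + k' * s'\<^sup>2) * (k * t\<^sup>2 + k' * t'\<^sup>2) - (k * (s * t) + k' * (s' * t'))\<^sup>2"
    by simp
  also have "\<dots> = k * k' * (lin r s' t')\<^sup>2"
    by (simp add: lin_def power2_eq_square algebra_simps)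
  finally show ?thesis
    using lin_eq_0_iff[OF assms(1,2)] assms(3) by auto
qed

lemma pt_nonzero: "r \<in> dirs \<Longrightarrow> (k, w) \<noteq> (0, 0) \<Longrightarrow> pt r k w \<noteq> 0"
  using pt_eq_iff[of r r k w 0 0] pt_0_0[of r] by auto

lemma span_pt:
  assumes "r \<in> dirs" "k \<noteq> 0" "w' \<noteq> 0"
  shows "vec.span {pt r k w, pt r 0 w'} = ruling r" "pt r k w \<notin> vec.span {pt r 0 w'}"
proof -
  have "x \<in> vec.span {pt r k w, pt r 0 w'}" if x: "x \<in> ruling r" for x
  proof -
    obtain k1 w1 where "x = pt r k1 w1" using x by (auto simp: ruling_def)
    then have "x = (k1 / k) *s pt r k w + ((w1 - k1 / k * w) / w') *s pt r 0 w'"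
      using assms by (simp add: pt_scale pt_add)
    then show ?thesis unfolding span_pair_iff by blast
  qed
  moreover have "vec.span {pt r k w, pt r 0 w'} \<subseteq> ruling r"
    by (intro vec.span_minimal subspace_ruling) (auto simp: pt_in_ruling)
  ultimately show "vec.span {pt r k w, pt r 0 w'} = ruling r" by blast
  show "pt r k w \<notin> vec.span {pt r 0 w'}"
    using assms by (auto simp: span_singleton_iff pt_scale pt_eq_iff)
qed

lemma dim_ruling:
  assumes "r \<in> dirs"
  shows "vec.dim (ruling r) = 2"
proof -
  have n: "pt r 1 0 \<notin> vec.span {pt r 0 1}" using span_pt(2)[OF assms, of 1 1 0] by simp
  moreover have "pt r 1 0 \<noteq> pt r 0 1" using assms by (simp add: pt_eq_iff)
  moreover have "pt r 0 1 \<noteq> 0" using pt_nonzero[OF assms] by simp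
  ultimately have "vec.independent {pt r 1 0, pt r 0 1}" "card {pt r 1 0, pt r 0 1} = 2"
    by (simp_all add: vec.independent_insert)
  then have "vec.dim (vec.span {pt r 1 0, pt r 0 1}) = 2"
    using vec.dim_span_eq_card_independent by metis
  then show ?thesis using span_pt(1)[OF assms, of 1 1 0] by simp
qed

definition gen :: "'a \<times> 'a \<Rightarrow> ('a ^ 4) set" where
  "gen r = ruling r \<inter> PG3"

lemma gen_in_generators:
  assumes "r \<in> dirs"
  shows "gen r \<in> generators X"
proof -
  have "gen r \<in> proj_lines"
    unfolding proj_lines_def proj_subspaces_def gen_def
    using subspace_ruling[of r] dim_ruling[OF assms] by (intro CollectI exI[of _ "ruling r"]) simp
  moreover have "gen r \<subseteq> X" using assms unfolding gen_def by (blast intro: mem_X_iff[THEN iffD2] singular_iff[THEN iffD2])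
  ultimately show ?thesis by (simp add: generators_def)
qed

text \<open>The sum of two basis vectors is singular. If they lie on different rulings, one of them
  is a multiple of the vertex by \<open>singular_add_pt\<close>, and the vertex lies on every
  ruling.\<close>

lemma singular_subspace_dim_2:
  assumes U: "vec.subspace U" "vec.dim U = 2" and sing: "\<And>x. x \<in> U \<Longrightarrow> singular x"
  shows "\<exists>r\<in>dirs. U = ruling r"
proof -
  obtain S where S: "S \<subseteq> U" "vec.independent S" "U \<subseteq> vec.span S" "card S = 2"
    using vec.basis_exists[of U] U(2) by metis
  obtain u v where uv: "S = {u, v}" using S(4) by (auto simp: card_2_iff)
  have mem: "u \<in> U" "v \<in> U" using S(1) uv by auto
  have "\<exists>r\<in>dirs. u \<in> ruling r \<and> v \<in> ruling r"
  proof -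
    obtain r r' where r: "r \<in> dirs" "u \<in> ruling r" and r': "r' \<in> dirs" "v \<in> ruling r'"
      using sing mem singular_iff by blast
    obtain k w where k: "u = pt r k w" using r by (auto simp: ruling_def)
    obtain k' w' where k': "v = pt r' k' w'" using r' by (auto simp: ruling_def)
    show ?thesis
    proof (cases "r = r'")
      case False
      have "singular (u + v)" using sing mem U(1) vec.subspace_add by blast
      then have "k = 0 \<or> k' = 0" using singular_add_pt[OF r(1) r'(1) False] k k' by simp
      then show ?thesis
      proof
        assume "k = 0"
        then have "u \<in> ruling r'" using k pt_0[of r w r'] pt_in_ruling by metis
        then show ?thesis using r' by blast
      next
        assume "k' = 0"
        then have "v \<in> ruling r" using k' pt_0[of r' w' r] pt_in_ruling by metis
        then show ?thesis using r by blast
      qed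
    qed (use r r' in blast)
  qed
  then obtain r where r: "r \<in> dirs" "u \<in> ruling r" "v \<in> ruling r" by blast
  then have "vec.span S \<subseteq> ruling r" by (intro vec.span_minimal subspace_ruling) (auto simp: uv)
  then have "U \<subseteq> ruling r" using S(3) by blast
  then have "U = ruling r"
    using vec.subspace_dim_equal[OF U(1) subspace_ruling] dim_ruling[OF r(1)] U(2) by simp
  then show ?thesis using r(1) by blast
qed

lemma generators_eq: "generators X = gen ` dirs"
proof
  show "gen ` dirs \<subseteq> generators X" using gen_in_generators by blast
  show "generators X \<subseteq> gen ` dirs"
  proof
    fix l assume l: "l \<in> generators X"
    then obtain U where U: "vec.subspace U" "vec.dim U = 2" "l = U \<inter> PG3" and "l \<subseteq> X"
      by (auto simp: generators_def proj_lines_def proj_subspaces_def)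
    have "singular x" if "x \<in> U" for x
    proof (cases "x = 0")
      case True
      then show ?thesis using singular_pt pt_0_0 by metis
    next
      case False
      then obtain k where k: "k \<noteq> 0" "k *s x \<in> PG3" using PG3_scale_exists by blast
      then have "k *s x \<in> X" using that U(1,3) \<open>l \<subseteq> X\<close> vec.subspace_scale by blast
      then have "singular (inverse k *s (k *s x))" using singular_scale mem_X_iff by blast
      then show ?thesis using k(1) by simp
    qed
    then obtain r where "r \<in> dirs" "U = ruling r" using singular_subspace_dim_2 U by blast
    then show "l \<in> gen ` dirs" by (auto simp: U(3) gen_def)
  qed
qed

definition S :: "'a ^ 4" where "S = pnorm (pt (1, 0) 0 1)"

lemma S_eq:
  assumes "x \<in> PG3" "x = pt r 0 w"
  shows "x = S"
proof -
  have "x = w *s pt (1, 0) 0 1" using assms(2) pt_0[of r w "(1, 0)"] by (simp add: pt_scale)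
  then show ?thesis using pnorm_eqI[OF assms(1)] unfolding S_def by metis
qed

lemma S_obtain: obtains m where "m \<noteq> 0" "\<And>r. S = pt r 0 m"
proof -
  have "pt (1, 0) 0 1 \<noteq> 0" by (rule pt_nonzero) (auto simp: dirs_def)
  then obtain m where "m \<noteq> 0" "S = m *s pt (1, 0) 0 1" using pnorm(2) S_def by metis
  then have "S = pt r 0 m" for r using pt_0[of "(1, 0)" m r] by (simp add: pt_scale)
  then show ?thesis using that \<open>m \<noteq> 0\<close> by blast
qed

lemma S_in_PG3: "S \<in> PG3"
  unfolding S_def by (rule pnorm(1), rule pt_nonzero) (auto simp: dirs_def)

lemma S_in_gen: "S \<in> gen r"
  using S_obtain S_in_PG3 by (metis IntI gen_def pt_in_ruling)

lemma gen_inter: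
  assumes "r \<in> dirs" "r' \<in> dirs" "r \<noteq> r'"
  shows "gen r \<inter> gen r' = {S}"
proof -
  have "x = S" if "x \<in> gen r" "x \<in> gen r'" for x
    using ruling_inter[OF assms, of x] that S_eq unfolding gen_def by blast
  then show ?thesis using S_in_gen by blast
qed

lemma vertex_eq: "vertex X = S"
  unfolding vertex_def
proof (rule the_equality)
  show "S \<in> PG3 \<and> (\<forall>g\<in>generators X. S \<in> g)"
    using S_in_PG3 S_in_gen by (auto simp: generators_eq)
next
  fix x assume "x \<in> PG3 \<and> (\<forall>g\<in>generators X. x \<in> g)"
  moreover have "(1, 0) \<in> dirs" "(0, 1) \<in> dirs" by (auto simp: dirs_def)
  ultimately show "x = S" using gen_inter[of "(1, 0)" "(0, 1)"] by (auto simp: generators_eq)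
qed

text \<open>Parametrizes the cone without its vertex bijectively: away from the vertex the parameter
  \<open>k\<close> can be scaled to 1.\<close>

definition npt :: "('a \<times> 'a) \<times> 'a \<Rightarrow> 'a ^ 4" where
  "npt = (\<lambda>(r, w). pnorm (pt r 1 w))"

lemma npt:
  assumes "r \<in> dirs"
  shows "npt (r, w) \<in> gen r" "npt (r, w) \<noteq> S" "\<exists>k. k \<noteq> 0 \<and> npt (r, w) = k *s pt r 1 w"
proof -
  have n: "pt r 1 w \<noteq> 0" using pt_nonzero[OF assms] by simp
  then show ex: "\<exists>k. k \<noteq> 0 \<and> npt (r, w) = k *s pt r 1 w" using pnorm(2) by (simp add: npt_def)
  then obtain k where k: "k \<noteq> 0" "npt (r, w) = pt r k (k * w)" by (auto simp: pt_scale)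
  show "npt (r, w) \<in> gen r"
    using k(2) pt_in_ruling pnorm(1)[OF n] by (simp add: gen_def npt_def)
  obtain m where "m \<noteq> 0" "\<And>r. S = pt r 0 m" using S_obtain by blast
  then show "npt (r, w) \<noteq> S" using k pt_eq_iff[OF assms assms] by metis
qed

lemma inj_on_npt: "inj_on npt (dirs \<times> UNIV)"
proof (rule inj_onI, clarsimp)
  fix a b w a' b' w' assume d: "(a, b) \<in> dirs" "(a', b') \<in> dirs" and eq: "npt ((a, b), w) = npt ((a', b'), w')"
  obtain k where k: "k \<noteq> 0" "npt ((a, b), w) = pt (a, b) k (k * w)"
    using npt(3)[OF d(1)] by (auto simp: pt_scale)
  obtain k' where k': "k' \<noteq> 0" "npt ((a', b'), w') = pt (a', b') k' (k' * w')"
    using npt(3)[OF d(2)] by (auto simp: pt_scale)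
  show "a = a' \<and> b = b' \<and> w = w'" using eq k k' pt_eq_iff[OF d] by auto
qed

lemma gen_eq:
  assumes "r \<in> dirs"
  shows "gen r = insert S ((\<lambda>w. npt (r, w)) ` UNIV)"
proof
  show "gen r \<subseteq> insert S ((\<lambda>w. npt (r, w)) ` UNIV)"
  proof
    fix x assume x: "x \<in> gen r"
    then obtain k w where kw: "x = pt r k w" "x \<in> PG3" by (auto simp: gen_def ruling_def)
    show "x \<in> insert S ((\<lambda>w. npt (r, w)) ` UNIV)"
    proof (cases "k = 0")
      case True
      then show ?thesis using S_eq kw by blast
    next
      case False
      then have "x = k *s pt r 1 (w / k)" using kw by (simp add: pt_scale)
      then have "npt (r, w / k) = x" using pnorm_eqI[OF kw(2)] unfolding npt_def by simp
      then show ?thesis by blast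
    qed
  qed
qed (use S_in_gen npt(1)[OF assms] in auto)

section \<open>Point counts on the cone\<close>

lemma card_gen:
  assumes "r \<in> dirs"
  shows "card (gen r) = CARD('a) + 1"
proof -
  have "inj (\<lambda>w. npt (r, w))" using inj_on_npt assms by (auto simp: inj_on_def)
  moreover have "S \<notin> (\<lambda>w. npt (r, w)) ` UNIV" using npt(2)[OF assms] by (metis imageE)
  ultimately show ?thesis by (simp add: gen_eq[OF assms] card_image)
qed

lemma X_eq_Union: "X = (\<Union>r\<in>dirs. gen r)"
  by (auto simp: mem_X_iff singular_iff gen_def)

lemma X_eq_npt: "X = insert S (npt ` (dirs \<times> UNIV))"
proof -
  have "(1, 0) \<in> dirs" by (simp add: dirs_def)
  then show ?thesis unfolding X_eq_Union by (force simp: gen_eq)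
qed

lemma S_notin_npt: "S \<notin> npt ` (dirs \<times> UNIV)"
  using npt(2) by force

lemma card_X: "card X = CARD('a)\<^sup>2 + CARD('a) + 1"
proof -
  have "card X = Suc (card (npt ` (dirs \<times> UNIV)))"
    unfolding X_eq_npt using S_notin_npt by simp
  also have "card (npt ` (dirs \<times> UNIV)) = card (dirs :: ('a \<times> 'a) set) * CARD('a)"
    by (simp add: card_image[OF inj_on_npt] card_cartesian_product)
  finally show ?thesis by (simp add: card_dirs power2_eq_square)
qed

lemma card_X_filter:
  "card {x \<in> X. P x} = (if P S then 1 else 0) + (\<Sum>r\<in>dirs. card {w. P (npt (r, w))})"
proof -
  have eq: "{x \<in> X. P x} = (if P S then {S} else {}) \<union> npt ` (SIGMA r:dirs. {w. P (npt (r, w))})"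
    unfolding X_eq_npt by auto
  have inj: "inj_on npt (SIGMA r:dirs. {w. P (npt (r, w))})"
    by (rule inj_on_subset[OF inj_on_npt]) auto
  have "S \<notin> npt ` (SIGMA r:dirs. {w. P (npt (r, w))})" using S_notin_npt by blast
  then have "card {x \<in> X. P x} = card (if P S then {S} else {}) + card (npt ` (SIGMA r:dirs. {w. P (npt (r, w))}))"
    unfolding eq by (intro card_Un_disjoint) auto
  then show ?thesis by (simp add: card_image[OF inj] card_SigmaI)
qed

end

lemma binary_form_Suc:
  "binary_form n G \<Longrightarrow> binary_form (Suc n) (\<lambda>s t. s * G s t + c * t ^ Suc n)"
  by auto

lemma binary_form_quadratic: "binary_form 2 (\<lambda>s t. a * s\<^sup>2 + b * (s * t) + c * t\<^sup>2)"
proof -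
  have "binary_form 0 (\<lambda>s t. a)" by simp
  from binary_form_Suc[OF binary_form_Suc[OF this, of b], of c]
  show ?thesis by (simp add: numeral_2_eq_2 algebra_simps del: binary_form.simps)
qed

lemma binary_form_quartic:
  "binary_form 4 (\<lambda>s t. a * s^4 + b * (s^3 * t) + c * (s\<^sup>2 * t\<^sup>2) + d * (s * t^3) + e * t^4)"
proof -
  have "binary_form 0 (\<lambda>s t. a)" by simp
  from binary_form_Suc[OF binary_form_Suc[OF binary_form_Suc[OF binary_form_Suc[OF this, of b], of c], of d], of e]
  show ?thesis by (simp add: numeral_eq_Suc algebra_simps del: binary_form.simps)
qed

lemma card_roots_le:
  fixes F :: "'a::{field,finite} \<Rightarrow> 'a \<Rightarrow> 'a"
  assumes "binary_form n F" "roots F \<noteq> dirs"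
  shows "card (roots F) \<le> n"
proof (rule ccontr)
  assume "\<not> card (roots F) \<le> n"
  then have "F s t = 0" for s t using binary_form_eq_0[OF assms(1)] by simp
  with assms(2) show False by (auto simp: roots_def)
qed

context cone_coordinates
begin

subsection \<open>Planes\<close>

definition secant :: "'a \<times> 'a \<Rightarrow> 'a \<times> 'a \<Rightarrow> ('a ^ 4) set" where
  "secant r r' = vec.span {pt r 1 0, pt r' 1 0, pt r 0 1}"

lemma span_pt_base: "r \<in> dirs \<Longrightarrow> vec.span {pt r 1 0, pt r' 0 1} = ruling r"
  using span_pt(1)[of r 1 1 0] pt_0[of r' 1 r] by simp

lemma ruling_subset_secant:
  assumes "r \<in> dirs" "r' \<in> dirs"
  shows "ruling r \<subseteq> secant r r'" "ruling r' \<subseteq> secant r r'"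
proof -
  show "ruling r \<subseteq> secant r r'"
    unfolding secant_def span_pt_base[OF assms(1), of r, symmetric] by (intro vec.span_mono) auto
  show "ruling r' \<subseteq> secant r r'"
    unfolding secant_def span_pt_base[OF assms(2), of r, symmetric] by (intro vec.span_mono) auto
qed

lemma secant_subset:
  assumes "vec.subspace U" "ruling r \<subseteq> U" "ruling r' \<subseteq> U"
  shows "secant r r' \<subseteq> U"
  unfolding secant_def using assms(2,3) pt_in_ruling by (intro vec.span_minimal assms(1)) blast

lemma dim_secant:
  assumes "r \<in> dirs" "r' \<in> dirs" "r \<noteq> r'"
  shows "vec.dim (secant r r') = 3"
proof -
  have 1: "pt r' 1 0 \<notin> vec.span {pt r 0 1}"
    using span_pt(2)[OF assms(2), of 1 1 0] pt_0[of r 1 r'] by simp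
  have "pt r 1 0 \<notin> ruling r'"
    using ruling_inter[OF assms, of "pt r 1 0"] pt_in_ruling pt_eq_iff[OF assms(1) assms(1)] by auto
  then have 2: "pt r 1 0 \<notin> vec.span {pt r' 1 0, pt r 0 1}" using span_pt_base[OF assms(2)] by simp
  have 3: "pt r 0 1 \<noteq> 0" using pt_nonzero[OF assms(1)] by simp
  have ne: "pt r' 1 0 \<noteq> pt r 0 1" "pt r 1 0 \<noteq> pt r' 1 0" "pt r 1 0 \<noteq> pt r 0 1"
    using assms by (simp_all add: pt_eq_iff)
  have "vec.independent {pt r 0 1}" using 3 by (simp add: vec.independent_insert)
  then have "vec.independent {pt r' 1 0, pt r 0 1}" by (rule vec.independent_insertI[OF 1])
  then have "vec.independent {pt r 1 0, pt r' 1 0, pt r 0 1}"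
    by (rule vec.independent_insertI[OF 2])
  moreover have "card {pt r 1 0, pt r' 1 0, pt r 0 1} = 3" using ne by simp
  ultimately show ?thesis unfolding secant_def
    using vec.dim_span_eq_card_independent by metis
qed

text \<open>The vertex component can be moved into the second summand. Then \<open>x\<close> is a
  sum of one vector from each ruling, and \<open>singular_add_pt\<close> applies.\<close>

lemma singular_in_secant:
  assumes "r \<in> dirs" "r' \<in> dirs" "r \<noteq> r'" "x \<in> secant r r'" "singular x"
  shows "x \<in> ruling r \<or> x \<in> ruling r'"
proof -
  obtain a where "x - a *s pt r 1 0 \<in> vec.span {pt r' 1 0, pt r 0 1}"
    using assms(4) unfolding secant_def vec.span_insert[of "pt r 1 0"] by blast
  then obtain b w where "x - a *s pt r 1 0 = pt r' b w"
    unfolding span_pt_base[OF assms(2)] by (auto simp: ruling_def)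
  then have x: "x = pt r a 0 + pt r' b w" by (simp add: pt_scale algebra_simps)
  then have "a = 0 \<or> b = 0" using singular_add_pt[OF assms(1-3)] assms(5) by blast
  then show ?thesis
  proof
    assume "a = 0"
    then show ?thesis using x pt_0_0[of r] pt_in_ruling by simp
  next
    assume "b = 0"
    then have "x = pt r a w" using x pt_0[of r' w r] by (simp add: pt_add)
    then show ?thesis using pt_in_ruling by simp
  qed
qed

lemma secant_Int_PG3_in_proj_planes:
  assumes "r \<in> dirs" "r' \<in> dirs" "r \<noteq> r'"
  shows "secant r r' \<inter> PG3 \<in> proj_planes"
  unfolding proj_planes_def proj_subspaces_def
  using dim_secant[OF assms] by (intro CollectI exI[of _ "secant r r'"]) (simp add: secant_def)

lemma through_generator_pair_iff:
  "through_generator_pair X P \<longleftrightarrow> (\<exists>r\<in>dirs. \<exists>r'\<in>dirs. r \<noteq> r' \<and> P = secant r r' \<inter> PG3)"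
proof
  assume "through_generator_pair X P"
  then obtain g h where gh: "P \<in> proj_planes" "g \<in> gen ` dirs" "h \<in> gen ` dirs" "g \<noteq> h" "g \<subseteq> P" "h \<subseteq> P"
    unfolding through_generator_pair_def generators_eq by blast
  then obtain r r' where r: "r \<in> dirs" "r' \<in> dirs" "gen r \<noteq> gen r'" "gen r \<subseteq> P" "gen r' \<subseteq> P"
    by blast
  obtain U where U: "vec.subspace U" "vec.dim U = 3" "P = U \<inter> PG3"
    using gh(1) by (auto simp: proj_planes_def proj_subspaces_def)
  have "ruling r \<subseteq> U" "ruling r' \<subseteq> U"
    using Int_PG3_subset_imp_subset[OF subspace_ruling U(1)] r(4,5) U(3) by (auto simp: gen_def)
  then have "secant r r' \<subseteq> U" by (rule secant_subset[OF U(1)])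
  moreover have "r \<noteq> r'" using r(3) by blast
  ultimately have "secant r r' = U"
    using vec.subspace_dim_equal[OF _ U(1)] dim_secant[OF r(1,2)] U(2) by (simp add: secant_def)
  then show "\<exists>r\<in>dirs. \<exists>r'\<in>dirs. r \<noteq> r' \<and> P = secant r r' \<inter> PG3"
    using r(1,2) U(3) \<open>r \<noteq> r'\<close> by blast
next
  assume "\<exists>r\<in>dirs. \<exists>r'\<in>dirs. r \<noteq> r' \<and> P = secant r r' \<inter> PG3"
  then obtain r r' where r: "r \<in> dirs" "r' \<in> dirs" "r \<noteq> r'" and P: "P = secant r r' \<inter> PG3" by blast
  have "gen r \<noteq> gen r'"
  proof
    assume "gen r = gen r'"
    then have "gen r = {S}" using gen_inter[OF r] by simp
    then show False using card_gen[OF r(1)] by simp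
  qed
  moreover have "gen r \<subseteq> P" "gen r' \<subseteq> P"
    using ruling_subset_secant[OF r(1,2)] unfolding gen_def P by blast+
  ultimately show "through_generator_pair X P"
    unfolding through_generator_pair_def P using secant_Int_PG3_in_proj_planes[OF r] gen_in_generators r
    by blast
qed

lemma secant_Int_X:
  assumes "r \<in> dirs" "r' \<in> dirs" "r \<noteq> r'"
  shows "secant r r' \<inter> PG3 \<inter> X = gen r \<union> gen r'"
proof
  show "secant r r' \<inter> PG3 \<inter> X \<subseteq> gen r \<union> gen r'"
  proof
    fix x assume "x \<in> secant r r' \<inter> PG3 \<inter> X"
    then have "x \<in> secant r r'" "singular x" "x \<in> PG3" by (simp_all add: mem_X_iff)
    then show "x \<in> gen r \<union> gen r'" using singular_in_secant[OF assms, of x] by (simp add: gen_def)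
  qed
  show "gen r \<union> gen r' \<subseteq> secant r r' \<inter> PG3 \<inter> X"
    using ruling_subset_secant[OF assms(1,2)] assms unfolding X_eq_Union gen_def by blast
qed

lemma card_secant_Int_X:
  assumes "r \<in> dirs" "r' \<in> dirs" "r \<noteq> r'"
  shows "card (secant r r' \<inter> PG3 \<inter> X) = 2 * CARD('a) + 1"
proof -
  have "card (gen r \<union> gen r') + card (gen r \<inter> gen r') = card (gen r) + card (gen r')"
    by (intro card_Un_Int[symmetric]) auto
  then show ?thesis
    unfolding secant_Int_X[OF assms] gen_inter[OF assms] card_gen[OF assms(1)] card_gen[OF assms(2)] by simp
qed

text \<open>A second common point would span a whole ruling together with the vertex, and the line
  would be a generator.\<close>

lemma vertex_line_Int_X:
  assumes "l \<in> proj_lines" "S \<in> l" "l \<notin> generators X"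
  shows "l \<inter> X = {S}"
proof -
  obtain U where U: "vec.subspace U" "vec.dim U = 2" "l = U \<inter> PG3"
    using assms(1) by (auto simp: proj_lines_def proj_subspaces_def)
  have "x = S" if x: "x \<in> l" "x \<in> X" for x
  proof (rule ccontr)
    assume "x \<noteq> S"
    obtain r where r: "r \<in> dirs" "x \<in> ruling r" using x(2) by (auto simp: mem_X_iff singular_iff)
    then obtain k w where kw: "x = pt r k w" by (auto simp: ruling_def)
    have "k \<noteq> 0" using S_eq[of x r w] \<open>x \<noteq> S\<close> kw x U(3) by auto
    obtain m where m: "m \<noteq> 0" "S = pt r 0 m" using S_obtain by metis
    have "vec.span {pt r k w, pt r 0 m} \<subseteq> U"
      using x(1) assms(2) kw m U by (intro vec.span_minimal) auto
    then have "ruling r \<subseteq> U" using span_pt(1)[OF r(1) \<open>k \<noteq> 0\<close> m(1)] by simp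
    then have "ruling r = U"
      using vec.subspace_dim_equal[OF subspace_ruling U(1)] dim_ruling[OF r(1)] U(2) by simp
    then have "l = gen r" by (simp add: U(3) gen_def)
    then show False using gen_in_generators[OF r(1)] assms(3) by simp
  qed
  moreover have "S \<in> X" using X_eq_npt by blast
  ultimately show ?thesis using assms(2) by blast
qed

lemma card_two_secant_planes_Int_X:
  assumes "two_secant_planes X Z"
  shows "card (X \<inter> Z) = 3 * CARD('a) + 1"
proof -
  obtain P Q where Z: "Z = P \<union> Q" and PQ: "through_generator_pair X P" "through_generator_pair X Q"
    "P \<inter> Q \<in> generators X"
    using assms by (auto simp: two_secant_planes_def)
  have 1: "card (P \<inter> X) = 2 * CARD('a) + 1" "card (Q \<inter> X) = 2 * CARD('a) + 1"
    using PQ card_secant_Int_X by (auto simp: through_generator_pair_iff)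
  have "P \<inter> X \<inter> (Q \<inter> X) = P \<inter> Q" using PQ(3) by (auto simp: generators_def)
  moreover have "card (P \<inter> Q) = CARD('a) + 1" using PQ(3) card_gen by (auto simp: generators_eq)
  moreover have "X \<inter> Z = (P \<inter> X) \<union> (Q \<inter> X)" using Z by blast
  moreover have "card (P \<inter> X) + card (Q \<inter> X) = card (P \<inter> X \<union> Q \<inter> X) + card (P \<inter> X \<inter> (Q \<inter> X))"
    by (intro card_Un_Int) auto
  \<comment> \<open>The count is 2(2q + 1) - (q + 1), as the planes share a whole generator.\<close>
  ultimately show ?thesis using 1 by simp
qed

lemma card_tangent_and_secant_plane_Int_X:
  assumes "tangent_and_secant_plane X Z"
  shows "card (X \<inter> Z) = 3 * CARD('a) + 1"
proof -
  obtain P Q where Z: "Z = P \<union> Q" and PQ: "tangent_plane X P" "through_generator_pair X Q"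
    "P \<inter> Q \<in> (if odd CARD('a) then external_vertex_tangents X else nonnuclear_vertex_lines X)"
    using assms unfolding tangent_and_secant_plane_def by blast
  have "P \<inter> X \<in> generators X" using PQ(1) by (simp add: tangent_plane_def)
  then have 1: "card (P \<inter> X) = CARD('a) + 1" using card_gen by (auto simp: generators_eq)
  have 2: "card (Q \<inter> X) = 2 * CARD('a) + 1"
    using PQ card_secant_Int_X by (auto simp: through_generator_pair_iff)
  have "P \<inter> Q \<in> proj_lines" "S \<in> P \<inter> Q" "P \<inter> Q \<notin> generators X"
    using PQ(3) unfolding external_vertex_tangents_def nonnuclear_vertex_lines_def vertex_eq
    by (auto split: if_splits)
  then have "P \<inter> Q \<inter> X = {S}" by (rule vertex_line_Int_X)
  then have "P \<inter> X \<inter> (Q \<inter> X) = {S}" by blast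
  moreover have "X \<inter> Z = (P \<inter> X) \<union> (Q \<inter> X)" using Z by blast
  moreover have "card (P \<inter> X) + card (Q \<inter> X) = card (P \<inter> X \<union> Q \<inter> X) + card (P \<inter> X \<inter> (Q \<inter> X))"
    by (intro card_Un_Int) auto
  \<comment> \<open>The count is (q + 1) + (2q + 1) - 1, as only the vertex is shared.\<close>
  ultimately show ?thesis using 1 2 by simp
qed

lemma weight_codeword: "weight X (codeword X f) + card {x \<in> X. f x = 0} = card X"
proof -
  have "weight X (codeword X f) = card {x \<in> X. f x \<noteq> 0}"
    unfolding weight_def codeword_def by (intro arg_cong[of _ _ card]) auto
  moreover have "card X = card ({x \<in> X. f x \<noteq> 0} \<union> {x \<in> X. f x = 0})"
    by (intro arg_cong[of _ _ card]) blast
  moreover have "\<dots> = card {x \<in> X. f x \<noteq> 0} + card {x \<in> X. f x = 0}"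
    by (intro card_Un_disjoint) auto
  ultimately show ?thesis by simp
qed

lemma X_Int_zero_set: "X \<inter> zero_set f = {x \<in> X. f x = 0}"
  by (auto simp: zero_set_def mem_X_iff)

text \<open>The linear form that restricts to the product of the two linear forms with roots \<open>r\<close> and \<open>r'\<close>.\<close>

definition chord :: "'a \<times> 'a \<Rightarrow> 'a \<times> 'a \<Rightarrow> 'a ^ 4 \<Rightarrow> 'a" where
  "chord r r' x = snd r * snd r' * (B *v x)$0 - (snd r * fst r' + fst r * snd r') * (B *v x)$1
     + fst r * fst r' * (B *v x)$2"

lemma chord_pt: "chord r r' (pt a k w) = k * (lin r (fst a) (snd a) * lin r' (fst a) (snd a))"
  by (simp add: chord_def pt_def lin_def power2_eq_square algebra_simps)

lemma chord_add: "chord r r' (x + y) = chord r r' x + chord r r' y"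
  by (simp add: chord_def matrix_vector_right_distrib algebra_simps)

lemma chord_scale: "chord r r' (k *s x) = k * chord r r' x"
  by (simp add: chord_def vector_scalar_commute algebra_simps)

lemma chord_mult_in_quad_forms: "(\<lambda>x. k * chord a b x * chord c d x) \<in> quad_forms"
proof -
  have chord: "chord r r' x = linfun (vec4 (snd r * snd r') (- (snd r * fst r' + fst r * snd r'))
      (fst r * fst r') 0) (B *v x)" for r r' x
    by (simp only: chord_def linfun_def vec4_nth mult_minus_left mult_zero_left add_0_right diff_conv_add_uminus)
  show ?thesis
    unfolding chord mult.assoc
    by (intro quad_forms_scale quad_forms_compose[where f = "\<lambda>y. linfun _ y * linfun _ y"] quad_forms_linfun_mult)
qed

lemma third_dir:
  fixes r r' :: "'a \<times> 'a"
  obtains a where "a \<in> dirs" "a \<noteq> r" "a \<noteq> r'"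
proof -
  have "card {r, r'} < card (dirs :: ('a \<times> 'a) set)"
  proof -
    have "card {0 :: 'a, 1} \<le> CARD('a)" by (intro card_mono) auto
    then show ?thesis by (simp add: card_dirs card_insert_if)
  qed
  then have "\<not> dirs \<subseteq> {r, r'}" using card_mono[of "{r, r'}" dirs] by auto
  then show ?thesis using that by auto
qed

text \<open>The linear form is nonzero at a point of a third generator, so its kernel has dimension
  at most 3 and cannot exceed the secant plane.\<close>

lemma chord_eq_0_iff:
  assumes "r \<in> dirs" "r' \<in> dirs" "r \<noteq> r'"
  shows "chord r r' x = 0 \<longleftrightarrow> x \<in> secant r r'"
proof -
  let ?K = "{x. chord r r' x = 0}"
  have K: "vec.subspace ?K"
    using chord_scale[of r r' 0 0] by (intro vec.subspaceI) (auto simp: chord_add chord_scale)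
  have "ruling r \<subseteq> ?K" "ruling r' \<subseteq> ?K"
    using lin_eq_0_iff[OF assms(1) assms(1)] lin_eq_0_iff[OF assms(2) assms(2)]
    by (auto simp: ruling_def chord_pt)
  then have sub: "secant r r' \<subseteq> ?K" by (rule secant_subset[OF K])
  obtain a where a: "a \<in> dirs" "a \<noteq> r" "a \<noteq> r'" using third_dir by blast
  have "chord r r' (pt a 1 0) \<noteq> 0"
    using lin_eq_0_iff[OF assms(1) a(1)] lin_eq_0_iff[OF assms(2) a(1)] a by (simp add: chord_pt)
  then have "?K \<noteq> UNIV" by blast
  moreover have "vec.span ?K = ?K" using K by (simp only: vec.span_eq_iff)
  ultimately have "vec.span ?K \<subset> vec.span UNIV" by (simp only: vec.span_UNIV psubset_eq subset_UNIV) simp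
  then have "vec.dim ?K < vec.dim (UNIV :: ('a ^ 4) set)" by (rule vec.dim_psubset)
  then have "vec.dim ?K \<le> 3" unfolding vec_dim_card by simp
  then have "secant r r' = ?K"
    using vec.subspace_dim_equal[OF _ K sub] dim_secant[OF assms] by (simp add: secant_def)
  then show ?thesis by blast
qed

section \<open>Restriction of forms to the cone\<close>

lemma quad_form_npt:
  assumes "f \<in> quad_forms" "r \<in> dirs"
  shows "f (npt (r, w)) = 0 \<longleftrightarrow> f (pt r 1 w) = 0"
  using npt(3)[OF assms(2), of w] quad_form_scale[OF assms(1)] by auto

lemma quad_form_S:
  assumes "f \<in> quad_forms"
  shows "f S = 0 \<longleftrightarrow> f (pt r 0 1) = 0"
proof -
  obtain m where "m \<noteq> 0" "S = pt r 0 m" using S_obtain by metis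
  then have "S = m *s pt r 0 1" by (simp add: pt_scale)
  then show ?thesis using \<open>m \<noteq> 0\<close> quad_form_scale[OF assms] by simp
qed

lemma card_zeros:
  assumes "f \<in> quad_forms"
  shows "card {x \<in> X. f x = 0} =
    (if f (pt (1, 0) 0 1) = 0 then 1 else 0) + (\<Sum>r\<in>dirs. card {w. f (pt r 1 w) = 0})"
  unfolding card_X_filter quad_form_S[OF assms, of "(1, 0)"]
  by (simp add: quad_form_npt[OF assms])

lemma quad_form_on_cone:
  assumes "f \<in> quad_forms"
  obtains a b c where "binary_form 2 b" "binary_form 4 c"
    "\<And>r w. f (pt r 1 w) = a * w\<^sup>2 + b (fst r) (snd r) * w + c (fst r) (snd r)"
    "\<And>r w. f (pt r 0 w) = a * w\<^sup>2"
proof -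
  obtain d where d: "(\<lambda>x. f (A *v x)) = qform d"
    using quad_forms_compose[OF assms, of A] by (auto simp: quad_forms_def)
  have f: "f (A *v x) = qform d x" for x using fun_cong[OF d] .
  show ?thesis
  proof
    show "binary_form 2 (\<lambda>s t. d 0 3 * s\<^sup>2 + d 1 3 * (s * t) + d 2 3 * t\<^sup>2)"
      by (rule binary_form_quadratic)
    \<comment> \<open>The monomials \<open>y$0 * y$2\<close> and \<open>y$1 * y$1\<close> agree on
      the cone, so their coefficients enter only through their sum.\<close>
    show "binary_form 4 (\<lambda>s t. d 0 0 * s^4 + d 0 1 * (s^3 * t) + (d 0 2 + d 1 1) * (s\<^sup>2 * t\<^sup>2)
       + d 1 2 * (s * t^3) + d 2 2 * t^4)"
      by (rule binary_form_quartic)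
    show "f (pt r 1 w) = d 3 3 * w\<^sup>2
       + (d 0 3 * (fst r)\<^sup>2 + d 1 3 * (fst r * snd r) + d 2 3 * (snd r)\<^sup>2) * w
       + (d 0 0 * fst r^4 + d 0 1 * (fst r^3 * snd r) + (d 0 2 + d 1 1) * ((fst r)\<^sup>2 * (snd r)\<^sup>2)
       + d 1 2 * (fst r * snd r^3) + d 2 2 * snd r^4)" for r w
      unfolding pt_def f qform_expand by (simp add: numeral_eq_Suc algebra_simps)
    show "f (pt r 0 w) = d 3 3 * w\<^sup>2" for r w
      unfolding pt_def f qform_expand by (simp add: power2_eq_square)
  qed
qed

subsection \<open>Weights\<close>

lemma card_field_ge_2: "CARD('a) \<ge> 2"
proof -
  have "card {0 :: 'a, 1} \<le> CARD('a)" by (intro card_mono) auto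
  then show ?thesis by simp
qed

text \<open>If \<open>a\<close> is nonzero, the vertex is not a zero and each of the q + 1
  generators carries at most two zeros, and 2q + 2 < 3q + 1. If \<open>a = 0\<close> and
  \<open>b\<close> is not zero everywhere, at most two generators lie in the quadric, and every
  other one has a single zero besides the vertex.\<close>

lemma many_zeros:
  assumes f: "f \<in> quad_forms" and N: "3 * CARD('a) + 1 \<le> card {x \<in> X. f x = 0}"
  obtains c where "binary_form 4 c" "\<And>r w. r \<in> dirs \<Longrightarrow> f (pt r 1 w) = c (fst r) (snd r)"
    "\<And>r w. f (pt r 0 w) = 0" "card {x \<in> X. f x = 0} = 1 + CARD('a) * card (roots c)"
proof -
  obtain b c a where b: "binary_form 2 b" and c: "binary_form 4 c"
    and f1: "\<And>r w. f (pt r 1 w) = a * w\<^sup>2 + b (fst r) (snd r) * w + c (fst r) (snd r)"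
    and f0: "\<And>r w. f (pt r 0 w) = a * w\<^sup>2"
    by (rule quad_form_on_cone[OF f], rule that)
  have a0: "a = 0"
  proof (rule ccontr)
    assume a: "a \<noteq> 0"
    have "card {x \<in> X. f x = 0} = (\<Sum>r\<in>dirs. card {w. f (pt r 1 w) = 0})"
      using a by (simp add: card_zeros[OF f] f0)
    also have "\<dots> \<le> (\<Sum>r\<in>(dirs :: ('a \<times> 'a) set). 2)"
    proof (rule sum_mono)
      fix r :: "'a \<times> 'a"
      show "card {w. f (pt r 1 w) = 0} \<le> 2"
        using card_quadratic_fibre_le[OF a, of UNIV "b (fst r) (snd r)" "c (fst r) (snd r)" 0]
        unfolding f1 by simp
    qed
    also have "\<dots> = 2 * (CARD('a) + 1)" by (simp add: card_dirs)
    finally have "3 * CARD('a) + 1 \<le> 2 * (CARD('a) + 1)" by (rule order_trans[OF N])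
    then show False using card_field_ge_2 by simp
  qed
  have b0: "roots b = dirs"
  proof (rule ccontr)
    assume n: "roots b \<noteq> dirs"
    then have k: "card (roots b) \<le> 2" using card_roots_le[OF b] by blast
    have sub: "roots b \<subseteq> dirs" by (auto simp: roots_def)
    have "card {x \<in> X. f x = 0} = 1 + (\<Sum>r\<in>dirs. card {w. f (pt r 1 w) = 0})"
      by (simp add: card_zeros[OF f] f0 a0)
    also have "(\<Sum>r\<in>dirs. card {w. f (pt r 1 w) = 0}) \<le> (\<Sum>r\<in>dirs. if r \<in> roots b then CARD('a) else 1)"
    proof (rule sum_mono)
      fix r :: "'a \<times> 'a" assume r: "r \<in> dirs"
      show "card {w. f (pt r 1 w) = 0} \<le> (if r \<in> roots b then CARD('a) else 1)"
      proof (cases "r \<in> roots b")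
        case True
        then show ?thesis by (simp add: card_mono)
      next
        case False
        then have "b (fst r) (snd r) \<noteq> 0" using r by (simp add: roots_def)
        then have "w = - c (fst r) (snd r) / b (fst r) (snd r)" if "f (pt r 1 w) = 0" for w
          using that unfolding f1 a0 by (simp add: field_simps eq_neg_iff_add_eq_0)
        then have "{w. f (pt r 1 w) = 0} \<subseteq> {- c (fst r) (snd r) / b (fst r) (snd r)}" by blast
        then have "card {w. f (pt r 1 w) = 0} \<le> card {- c (fst r) (snd r) / b (fst r) (snd r)}"
          by (intro card_mono) auto
        then show ?thesis using False by simp
      qed
    qed
    also have "\<dots> = card (roots b) * CARD('a) + card (dirs - roots b)"
    proof -
      have "dirs \<inter> {r. r \<in> roots b} = roots b" "dirs \<inter> - {r. r \<in> roots b} = dirs - roots b"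
        using sub by auto
      then show ?thesis by (simp add: sum.If_cases)
    qed
    also have "card (dirs - roots b) = CARD('a) + 1 - card (roots b)"
      using sub by (simp add: card_Diff_subset card_dirs)
    finally have le: "card {x \<in> X. f x = 0} \<le> 1 + (card (roots b) * CARD('a) + (CARD('a) + 1 - card (roots b)))"
      by simp
    \<comment> \<open>The three bounds are q + 2, 2q + 1 and 3q; the case split also resolves the
      truncated subtraction.\<close>
    from k consider "card (roots b) = 0" | "card (roots b) = 1" | "card (roots b) = 2" by linarith
    then show False using le N card_field_ge_2 by cases auto
  qed
  show ?thesis
  proof (rule that[OF c])
    show fc: "f (pt r 1 w) = c (fst r) (snd r)" if "r \<in> dirs" for r w
      using that b0 by (auto simp: f1 a0 roots_def)
    show "f (pt r 0 w) = 0" for r w by (simp add: f0 a0)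
    have "card {x \<in> X. f x = 0} = 1 + (\<Sum>r\<in>dirs. card {w. f (pt r 1 w) = 0})"
      by (simp add: card_zeros[OF f] f0 a0)
    also have "(\<Sum>r\<in>dirs. card {w. f (pt r 1 w) = 0}) = (\<Sum>r\<in>dirs. if r \<in> roots c then CARD('a) else 0)"
      by (intro sum.cong refl) (simp add: fc roots_def)
    also have "\<dots> = card (roots c) * CARD('a)"
    proof -
      have "dirs \<inter> {r. r \<in> roots c} = roots c" by (auto simp: roots_def)
      then show ?thesis by (simp add: sum.If_cases)
    qed
    finally show "card {x \<in> X. f x = 0} = 1 + CARD('a) * card (roots c)" by (simp add: mult.commute)
  qed
qed

lemma codeword_eqI:
  assumes "f \<in> quad_forms" "g \<in> quad_forms" "f S = 0" "g S = 0"
    and "\<And>r w. r \<in> dirs \<Longrightarrow> f (pt r 1 w) = g (pt r 1 w)"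
  shows "codeword X f = codeword X g"
proof -
  have "f x = g x" if "x \<in> X" for x
  proof -
    have "x \<in> insert S (npt ` (dirs \<times> UNIV))" using that X_eq_npt by blast
    then consider "x = S" | r w where "r \<in> dirs" "x = npt (r, w)" by blast
    then show ?thesis
    proof cases
      case 1
      then show ?thesis using assms(3,4) by simp
    next
      case 2
      then show ?thesis
        using npt(3)[OF 2(1), of w] quad_form_scale[OF assms(1)] quad_form_scale[OF assms(2)] assms(5)[OF 2(1)] 2(2) by auto
    qed
  qed
  then show ?thesis unfolding codeword_def by (rule restrict_ext)
qed

text \<open>The planes \<open>chord r1 r\<close> form the pencil through the generator of
  \<open>r1\<close>: the equation is linear in \<open>r\<close> with coefficients \<open>u\<close>
  and \<open>v\<close>. Vanishing for two different directions \<open>r\<close> forces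
  \<open>u = v = 0\<close>, and then the cone equation holds.\<close>

lemma two_secant_planes_chords:
  assumes r: "r1 \<in> dirs" "r2 \<in> dirs" "r3 \<in> dirs" "r1 \<noteq> r2" "r1 \<noteq> r3" "r2 \<noteq> r3" and k: "k \<noteq> 0"
  shows "two_secant_planes X (zero_set (\<lambda>x. k * chord r1 r2 x * chord r1 r3 x))"
proof -
  let ?P = "secant r1 r2 \<inter> PG3" and ?Q = "secant r1 r3 \<inter> PG3"
  note P = chord_eq_0_iff[OF r(1,2,4)] and Q = chord_eq_0_iff[OF r(1,3,5)]
  have Z: "zero_set (\<lambda>x. k * chord r1 r2 x * chord r1 r3 x) = ?P \<union> ?Q"
    using k by (auto simp: zero_set_def P Q)
  have "x \<in> ruling r1" if x: "chord r1 r2 x = 0" "chord r1 r3 x = 0" for x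
  proof -
    define u where "u = snd r1 * (B *v x)$0 - fst r1 * (B *v x)$1"
    define v where "v = snd r1 * (B *v x)$1 - fst r1 * (B *v x)$2"
    have c: "chord r1 r x = snd r * u - fst r * v" for r
      by (simp add: chord_def u_def v_def algebra_simps)
    have eq: "snd r2 * u = fst r2 * v" "snd r3 * u = fst r3 * v"
      using x unfolding c by simp_all
    have uv: "u = 0" "v = 0" using eq r(2,3,6) by (auto simp: dirs_def)
    have "singular x"
      using uv r(1) unfolding u_def v_def singular_def
      by (auto simp: dirs_def power2_eq_square)
    then have "x \<in> ruling r1 \<or> x \<in> ruling r2" "x \<in> ruling r1 \<or> x \<in> ruling r3"
      using singular_in_secant r x chord_eq_0_iff by blast+
    \<comment> \<open>In the remaining case \<open>x\<close> is on the rulings of \<open>r2\<close>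
      and \<open>r3\<close>, hence a multiple of the vertex, which is also on the ruling of
      \<open>r1\<close>.\<close>
    then show ?thesis
      using ruling_inter[OF r(2,3,6), of x] pt_0[of r2 _ r1] pt_in_ruling by metis
  qed
  then have "?P \<inter> ?Q \<subseteq> gen r1" unfolding gen_def P Q by blast
  moreover have "gen r1 \<subseteq> ?P \<inter> ?Q"
    using ruling_subset_secant(1)[OF r(1,2)] ruling_subset_secant(1)[OF r(1,3)] unfolding gen_def by blast
  ultimately have I: "?P \<inter> ?Q = gen r1" by blast
  have "?P \<noteq> ?Q"
  proof
    assume "?P = ?Q"
    then have "gen r2 \<subseteq> gen r1"
      using I ruling_subset_secant(2)[OF r(1,2)] unfolding gen_def by blast
    then have "gen r2 = {S}" using gen_inter[OF r(1,2,4)] by blast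
    then show False using card_gen[OF r(2)] by simp
  qed
  then show ?thesis
    unfolding two_secant_planes_def Z
    using I gen_in_generators[OF r(1)] r through_generator_pair_iff by metis
qed

text \<open>The source of words of both small weights: four distinct directions give q(q - 3), and
  one repetition gives q(q - 2). The factor 1 fits the shape of
  \<open>chord_mult_in_quad_forms\<close>.\<close>

lemma chords_on_cone:
  assumes "a \<in> dirs" "b \<in> dirs" "c \<in> dirs" "d \<in> dirs"
  shows "card {x \<in> X. 1 * chord a b x * chord c d x = 0} = 1 + CARD('a) * card {a, b, c, d}"
proof -
  let ?T = "{a, b, c, d}"
  have "card {x \<in> X. 1 * chord a b x * chord c d x = 0} =
      1 + (\<Sum>r\<in>dirs. card {w. 1 * chord a b (pt r 1 w) * chord c d (pt r 1 w) = 0})"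
    by (subst card_zeros[OF chord_mult_in_quad_forms]) (simp add: chord_pt)
  also have "(\<Sum>r\<in>dirs. card {w. 1 * chord a b (pt r 1 w) * chord c d (pt r 1 w) = 0})
      = (\<Sum>r\<in>dirs. if r \<in> ?T then CARD('a) else 0)"
  proof (rule sum.cong)
    fix r :: "'a \<times> 'a" assume r: "r \<in> dirs"
    show "card {w. 1 * chord a b (pt r 1 w) * chord c d (pt r 1 w) = 0} = (if r \<in> ?T then CARD('a) else 0)"
      unfolding chord_pt mult_eq_0_iff using lin_eq_0_iff[OF _ r] assms by auto
  qed simp
  also have "\<dots> = card ?T * CARD('a)"
  proof -
    have "dirs \<inter> {r. r \<in> ?T} = ?T" using assms by auto
    then show ?thesis by (subst sum.If_cases) (simp_all only: finite, simp)
  qed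
  finally show ?thesis by (simp add: mult.commute)
qed

lemma weight_eq_iff:
  assumes "CARD('a) \<ge> 3"
  shows "weight X (codeword X f) = CARD('a) * (CARD('a) - 2) \<longleftrightarrow> card {x \<in> X. f x = 0} = 3 * CARD('a) + 1"
proof -
  \<comment> \<open>Writing q = m + 2 removes the truncated subtraction from q^2 + q + 1 = q(q - 2)
    + (3q + 1).\<close>
  have "CARD('a) = CARD('a) - 2 + 2" using assms by simp
  then obtain m where m: "CARD('a) = m + 2" by blast
  have "CARD('a)\<^sup>2 + CARD('a) + 1 = CARD('a) * (CARD('a) - 2) + (3 * CARD('a) + 1)"
    unfolding m by (simp add: power2_eq_square algebra_simps)
  then show ?thesis using weight_codeword[of f] unfolding card_X by auto
qed

lemma weight_characterization:
  assumes q: "CARD('a) \<ge> 3" and v: "v \<in> func_code X"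
  shows "weight X v = CARD('a) * (CARD('a) - 2) \<longleftrightarrow>
    (\<exists>f\<in>quad_forms. v = codeword X f \<and>
       (two_secant_planes X (zero_set f) \<or> tangent_and_secant_plane X (zero_set f)))"
proof
  assume w: "weight X v = CARD('a) * (CARD('a) - 2)"
  obtain h where h: "h \<in> quad_forms" "v = codeword X h" using v by (auto simp: func_code_def)
  have N: "card {x \<in> X. h x = 0} = 3 * CARD('a) + 1" using w weight_eq_iff[OF q] h(2) by simp
  obtain c where c: "binary_form 4 c" "\<And>r w. r \<in> dirs \<Longrightarrow> h (pt r 1 w) = c (fst r) (snd r)"
    "\<And>r w. h (pt r 0 w) = 0" "card {x \<in> X. h x = 0} = 1 + CARD('a) * card (roots c)"
    by (rule many_zeros[OF h(1) eq_refl[OF N[symmetric]]], rule that)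
  have "CARD('a) * card (roots c) = CARD('a) * 3" using c(4) N by simp
  then have card: "card (roots c) = 3" using q by simp
  then obtain r1 r2 r3 k where r: "r1 \<in> dirs" "r2 \<in> dirs" "r3 \<in> dirs" "r1 \<noteq> r2" "r1 \<noteq> r3" "r2 \<noteq> r3"
    and fac: "\<And>s t. c s t = k * (lin r1 s t * lin r2 s t) * (lin r1 s t * lin r3 s t)"
    using quartic_with_three_roots[OF c(1)] by metis
  have k: "k \<noteq> 0"
  proof
    assume "k = 0"
    \<comment> \<open>All q + 1 points would be roots, which is more than 3.\<close>
    then have "roots c = dirs" by (auto simp: roots_def fac)
    then show False using card q by (simp add: card_dirs)
  qed
  let ?f = "\<lambda>x. k * chord r1 r2 x * chord r1 r3 x"
  have "codeword X h = codeword X ?f"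
  proof (rule codeword_eqI[OF h(1) chord_mult_in_quad_forms])
    show "h S = 0" using quad_form_S[OF h(1)] c(3) by simp
    show "?f S = 0" using quad_form_S[OF chord_mult_in_quad_forms, of k r1 r2 r1 r3 "(1, 0)"] by (simp add: chord_pt)
    show "h (pt r 1 w) = ?f (pt r 1 w)" if "r \<in> dirs" for r w
      by (simp add: c(2)[OF that] fac chord_pt)
  qed
  then have "v = codeword X ?f" using h(2) by simp
  then show "\<exists>f\<in>quad_forms. v = codeword X f \<and>
       (two_secant_planes X (zero_set f) \<or> tangent_and_secant_plane X (zero_set f))"
    by (intro bexI[of _ ?f] conjI disjI1 chord_mult_in_quad_forms two_secant_planes_chords[OF r k])
next
  assume "\<exists>f\<in>quad_forms. v = codeword X f \<and>
       (two_secant_planes X (zero_set f) \<or> tangent_and_secant_plane X (zero_set f))"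
  then obtain f where f: "v = codeword X f"
    "two_secant_planes X (zero_set f) \<or> tangent_and_secant_plane X (zero_set f)" by blast
  then have "card (X \<inter> zero_set f) = 3 * CARD('a) + 1"
    using card_two_secant_planes_Int_X card_tangent_and_secant_plane_Int_X by blast
  then show "weight X v = CARD('a) * (CARD('a) - 2)"
    using weight_eq_iff[OF q] by (simp add: f(1) X_Int_zero_set)
qed

text \<open>Such a weight leaves the quartic more than three roots, and positivity means that not
  all points are roots; so there are exactly four.\<close>

lemma small_weight:
  assumes q: "CARD('a) \<ge> 4" and v: "v \<in> func_code X" and w: "0 < weight X v" "weight X v < CARD('a) * (CARD('a) - 2)"
  shows "weight X v = CARD('a) * (CARD('a) - 3)"
proof -
  obtain h where h: "h \<in> quad_forms" "v = codeword X h" using v by (auto simp: func_code_def)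
  have "CARD('a) = CARD('a) - 3 + 3" using q by simp
  then obtain m where m: "CARD('a) = m + 3" by blast
  have N: "3 * CARD('a) + 1 < card {x \<in> X. h x = 0}"
    using w(2) weight_codeword[of h] unfolding h(2) card_X m by (simp add: power2_eq_square algebra_simps)
  obtain c where c: "binary_form 4 c" and "\<And>r w. r \<in> dirs \<Longrightarrow> h (pt r 1 w) = c (fst r) (snd r)"
    and "\<And>r w. h (pt r 0 w) = 0" and cN: "card {x \<in> X. h x = 0} = 1 + CARD('a) * card (roots c)"
    by (rule many_zeros[OF h(1) less_imp_le[OF N]], rule that)
  have "CARD('a) * 3 < CARD('a) * card (roots c)" using N cN by simp
  then have ge: "3 < card (roots c)" by simp
  have "roots c \<noteq> dirs"
  proof
    assume "roots c = dirs"
    then show False using w(1) weight_codeword[of h] cN unfolding h(2) card_X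
      by (simp add: card_dirs power2_eq_square)
  qed
  then have "card (roots c) = 4" using card_roots_le[OF c] ge by simp
  then show ?thesis
    using weight_codeword[of h] cN unfolding h(2) card_X m by (simp add: power2_eq_square algebra_simps)
qed

lemma four_dirs:
  assumes "CARD('a) \<ge> 4"
  obtains a b c d :: "'a \<times> 'a" where "a \<in> dirs" "b \<in> dirs" "c \<in> dirs" "d \<in> dirs" "card {a, b, c, d} = 4"
    "card {a, b, c} = 3"
proof -
  have "card {0 :: 'a, 1} < CARD('a)" using assms by simp
  then have "\<not> UNIV \<subseteq> {0 :: 'a, 1}" using card_mono[of "{0 :: 'a, 1}" UNIV] by auto
  then obtain z :: 'a where "z \<noteq> 0" "z \<noteq> 1" by auto
  then show ?thesis using that[of "(1, 0)" "(0, 1)" "(1, 1)" "(z, 1)"] by (simp add: dirs_def)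
qed

lemma min_and_second_weight:
  assumes q: "CARD('a) \<ge> 4"
  shows "min_distance X = CARD('a) * (CARD('a) - 3)" "second_weight X = CARD('a) * (CARD('a) - 2)"
proof -
  obtain a b c d :: "'a \<times> 'a" where r: "a \<in> dirs" "b \<in> dirs" "c \<in> dirs" "d \<in> dirs"
    and card: "card {a, b, c, d} = 4" "card {a, b, c} = 3" using four_dirs[OF q] by metis
  have "CARD('a) = CARD('a) - 3 + 3" using q by simp
  then obtain m where m: "CARD('a) = m + 3" by blast
  have mem: "codeword X (\<lambda>x. 1 * chord a b x * chord c d x) \<in> func_code X" for a b c d
    unfolding func_code_def by (intro imageI chord_mult_in_quad_forms)
  have w1: "weight X (codeword X (\<lambda>x. 1 * chord a b x * chord c d x)) = CARD('a) * (CARD('a) - 3)"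
    using weight_codeword[of "\<lambda>x. 1 * chord a b x * chord c d x"]
    unfolding chords_on_cone[OF r] card card_X m by (simp add: power2_eq_square algebra_simps)
  have ex1: "CARD('a) * (CARD('a) - 3) \<in> weight X ` func_code X"
    using imageI[OF mem[of a b c d], of "weight X"] unfolding w1 .
  \<comment> \<open>Repeating \<open>a\<close> makes it a double root, which leaves three distinct
    ones.\<close>
  have "{a, b, a, c} = {a, b, c}" by auto
  then have w2: "weight X (codeword X (\<lambda>x. 1 * chord a b x * chord a c x)) = CARD('a) * (CARD('a) - 2)"
    using weight_codeword[of "\<lambda>x. 1 * chord a b x * chord a c x"]
    unfolding chords_on_cone[OF r(1,2,1,3)] card_X m by (simp add: card power2_eq_square algebra_simps)
  have ex2: "CARD('a) * (CARD('a) - 2) \<in> weight X ` func_code X"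
    using imageI[OF mem[of a b a c], of "weight X"] unfolding w2 .
  have lt: "CARD('a) * (CARD('a) - 3) < CARD('a) * (CARD('a) - 2)" "0 < CARD('a) * (CARD('a) - 3)"
    using q by simp_all
  have small: "w = CARD('a) * (CARD('a) - 3)"
    if "w \<in> weight X ` func_code X" "0 < w" "w < CARD('a) * (CARD('a) - 2)" for w
    using small_weight[OF q] that by blast
  show min: "min_distance X = CARD('a) * (CARD('a) - 3)"
    unfolding min_distance_def
  proof (rule Least_equality)
    fix w assume "w \<in> weight X ` func_code X \<and> 0 < w"
    then show "CARD('a) * (CARD('a) - 3) \<le> w"
    proof (rule contrapos_pp)
      assume "\<not> CARD('a) * (CARD('a) - 3) \<le> w"
      then have "w < CARD('a) * (CARD('a) - 3)" by (rule not_le_imp_less)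
      then have "w \<noteq> CARD('a) * (CARD('a) - 3)" "w < CARD('a) * (CARD('a) - 2)"
        using less_trans[OF _ lt(1)] by blast+
      then show "\<not> (w \<in> weight X ` func_code X \<and> 0 < w)" using small by blast
    qed
  qed (use ex1 lt in simp)
  show "second_weight X = CARD('a) * (CARD('a) - 2)"
    unfolding second_weight_def min
  proof (rule Least_equality)
    fix w assume "w \<in> weight X ` func_code X \<and> CARD('a) * (CARD('a) - 3) < w"
    then show "CARD('a) * (CARD('a) - 2) \<le> w"
    proof (rule contrapos_pp)
      assume "\<not> CARD('a) * (CARD('a) - 2) \<le> w"
      then have "w < CARD('a) * (CARD('a) - 2)" by (rule not_le_imp_less)
      then show "\<not> (w \<in> weight X ` func_code X \<and> CARD('a) * (CARD('a) - 3) < w)"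
        using small[of w] less_trans[OF lt(2), of w] less_irrefl[of w] by metis
    qed
  qed (use ex2 lt in simp)
qed

end

lemma quadric_cone_coordinates:
  fixes X :: "('a::{field,finite} ^ 4) set"
  assumes "quadric_cone X"
  obtains A B where "cone_coordinates A B X"
proof -
  obtain f where f: "f \<in> quad_forms" "form_rank f = 3" "X = zero_set f"
    using assms by (auto simp: quadric_cone_def)
  obtain A :: "'a ^ 4 ^ 4" and c where A: "invertible A" "c \<noteq> 0"
    "\<And>y. f (A *v y) = c * (y$0 * y$2 - (y$1)\<^sup>2)"
    using cone_normal_form[OF f(1,2)] by blast
  obtain B where B: "A ** B = mat 1" "B ** A = mat 1" using A(1) by (auto simp: invertible_def)
  have "f x = c * ((B *v x)$0 * (B *v x)$2 - ((B *v x)$1)\<^sup>2)" for x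
    using A(3)[of "B *v x"] by (simp add: matrix_vector_mul_assoc B)
  then have "X = {x \<in> PG3. (B *v x)$0 * (B *v x)$2 = ((B *v x)$1)\<^sup>2}"
    using A(2) by (auto simp: f(3) zero_set_def)
  then show ?thesis using that B by (simp add: cone_coordinates_def)
qed

text \<open>The first part fixes the weight by its value, which covers q = 3 as well. The second
  part relies on words of positive weight q(q - 3), which make q(q - 2) the second weight.\<close>

theorem theorem5p5:
  fixes X :: "('a::{field,finite} ^ 4) set"
  assumes "CARD('a) \<ge> 3" and "quadric_cone X"
  shows "(\<forall>v\<in>func_code X. weight X v = CARD('a) * (CARD('a) - 2) \<longleftrightarrow>
            (\<exists>f\<in>quad_forms. v = codeword X f \<and>
               (two_secant_planes X (zero_set f) \<or> tangent_and_secant_plane X (zero_set f))))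
       \<and> (CARD('a) \<ge> 4 \<longrightarrow>
          (\<forall>v\<in>func_code X. weight X v = second_weight X \<longleftrightarrow>
            (\<exists>f\<in>quad_forms. v = codeword X f \<and>
               (two_secant_planes X (zero_set f) \<or> tangent_and_secant_plane X (zero_set f)))))"
proof -
  obtain A B where "cone_coordinates A B X"
    using quadric_cone_coordinates[OF assms(2)] by blast
  then interpret cone_coordinates A B X .
  show ?thesis
    using weight_characterization[OF assms(1)] min_and_second_weight(2) by simp
qed

end
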